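(* Let $\partial\Omega=\Gamma_0\cup\Gamma_2\cup\Gamma_3$. The saddle-point problem of finding $(u,\vec v,\vec\alpha)\in L^2(\Omega)\times H_0^{\Gamma_3}(\mathrm{div};\Omega)\times H_0^{\Gamma_2\cup\Gamma_3}(\mathrm{div};\Omega)$ such that $$a\big((u,\vec v),(\phi,\vec\psi)\big)+b\big((\phi,\vec\psi),\vec\alpha\big)=F(\phi),\qquad b\big((u,\vec v),\vec\beta\big)=0$$ for all $(\phi,\vec\psi,\vec\beta)\in L^2(\Omega)\times H_0^{\Gamma_3}(\mathrm{div};\Omega)\times H_0^{\Gamma_2\cup\Gamma_3}(\mathrm{div};\Omega)$ has a unique solution for any $c_0>0$ and $c_1>0$.
   Context: $\Omega\subset\mathbb R^d$, $d\in\{2,3\}$, is an open, connected, bounded polytope with Lipschitz boundary and outward pointing normal $\vec n$; $c_0,c_1$ are constants. The $\Gamma_i$ are segments of $\partial\Omega$ carrying different boundary conditions for the fourth-order problem $\Delta^2u-c_0\Delta u+c_1u=f$: $u=\Delta u=0$ on $\Gamma_0$, $\frac{\partial(\Delta u-c_0u)}{\partial n}=\Delta u=0$ on $\Gamma_2$, and $\frac{\partial(\Delta u-c_0u)}{\partial n}=\frac{\partial u}{\partial n}=0$ on $\Gamma_3$. The datum satisfies $f\in V^*$, the dual space of $V=\{v\in H^1(\Omega):\Delta v\in L^2(\Omega)\}$ (with inner product $\int_\Omega uv+\nabla u\cdot\nabla v+\Delta u\,\Delta v$). For $\Gamma\subset\partial\Omega$, $H_0^{\Gamma}(\mathrm{div};\Omega)=\{\vec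 v\in H(\mathrm{div};\Omega): \vec v\cdot\vec n=0\text{ on }\Gamma\}$. The forms are $$a\big((u,\vec v),(\phi,\vec\psi)\big)=c_0\int_\Omega\vec v\cdot\vec\psi+\int_\Omega\nabla\cdot\vec v\,\nabla\cdot\vec\psi+c_1\int_\Omega u\phi,$$ $$b\big((u,\vec v),\vec\beta\big)=\int_\Omega\vec\beta\cdot\vec v+u\,\nabla\cdot\vec\beta,\qquad F(\phi)=\int_\Omega f\phi.$$
   Formalization: For f in V* the integral F(φ)=∫fφ is undefined for general φ in L²; F is assumed to be a bounded linear functional on L² that agrees with f on V, which any solution forces (take ψ=0). Uniqueness is up to equality a.e. *)

theory Defs
  imports "HOL-Analysis.Analysis"
begin

text \<open>Near every boundary point, in coordinates whose last axis is the unit vector \<open>e\<close>, the set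
  is the strict epigraph of a Lipschitz function \<open>g\<close> of the remaining coordinates.\<close>

definition lipschitz_boundary :: "(real^'n) set \<Rightarrow> bool" where
  "lipschitz_boundary \<Omega> \<longleftrightarrow>
     (\<forall>x\<in>frontier \<Omega>. \<exists>e r L (g :: real^'n \<Rightarrow> real).
        norm e = 1 \<and> r > 0 \<and> L-lipschitz_on {z. z \<bullet> e = 0} g \<and>
        \<Omega> \<inter> ball x r = {y \<in> ball x r. y \<bullet> e > g (y - (y \<bullet> e) *\<^sub>R e)})"

text \<open>The polytope need not be convex: its closure is a finite union of convex polytopes.\<close>

definition lipschitz_polytope_domain :: "(real^'n) set \<Rightarrow> bool" where
  "lipschitz_polytope_domain \<Omega> \<longleftrightarrow>
     open \<Omega> \<and> connected \<Omega> \<and> bounded \<Omega> \<and> \<Omega> \<noteq> {} \<and>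
     (\<exists>\<P>. finite \<P> \<and> (\<forall>P\<in>\<P>. polytope P) \<and> closure \<Omega> = \<Union>\<P>) \<and>
     lipschitz_boundary \<Omega>"

text \<open>The interior and closure are those of the subspace \<open>frontier \<Omega>\<close>. Segments may be empty, and
  may or may not contain their end points (edges).\<close>

definition boundary_segment :: "(real^'n) set \<Rightarrow> (real^'n) set \<Rightarrow> bool" where
  "boundary_segment \<Omega> \<Gamma> \<longleftrightarrow>
     \<Gamma> \<subseteq> frontier \<Omega> \<and> \<Gamma> \<subseteq> closure (top_of_set (frontier \<Omega>) interior_of \<Gamma>)"

definition nonoverlapping :: "(real^'n) set \<Rightarrow> (real^'n) set \<Rightarrow> (real^'n) set \<Rightarrow> bool" where
  "nonoverlapping \<Omega> \<Gamma> \<Gamma>' \<longleftrightarrow>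
     (top_of_set (frontier \<Omega>) interior_of \<Gamma>) \<inter> (top_of_set (frontier \<Omega>) interior_of \<Gamma>') = {}"

definition grad :: "(real^'n \<Rightarrow> real) \<Rightarrow> real^'n \<Rightarrow> real^'n" where
  "grad f x = (\<chi> i. frechet_derivative f (at x) (axis i 1))"

primrec C_k :: "nat \<Rightarrow> (real^'n \<Rightarrow> real) \<Rightarrow> bool" where
  "C_k 0 f \<longleftrightarrow> continuous_on UNIV f"
| "C_k (Suc k) f \<longleftrightarrow> f differentiable_on UNIV \<and> (\<forall>i. C_k k (\<lambda>x. grad f x $ i))"

definition smooth :: "(real^'n \<Rightarrow> real) \<Rightarrow> bool" where
  "smooth f \<longleftrightarrow> (\<forall>k. C_k k f)"

definition supp :: "(real^'n \<Rightarrow> real) \<Rightarrow> (real^'n) set" where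
  "supp f = closure {x. f x \<noteq> 0}"

definition test_functions :: "(real^'n) set \<Rightarrow> (real^'n \<Rightarrow> real) set" where
  "test_functions \<Omega> = {\<phi>. smooth \<phi> \<and> compact (supp \<phi>) \<and> supp \<phi> \<subseteq> \<Omega>}"

text \<open>Elements of the spaces below are functions on the whole space of which only the values on
  \<open>\<Omega>\<close> matter; they are not identified when they agree almost everywhere in \<open>\<Omega>\<close>.\<close>

definition L2 :: "(real^'n) set \<Rightarrow> (real^'n \<Rightarrow> 'b::euclidean_space) set" where
  "L2 \<Omega> = {u. u \<in> borel_measurable (lebesgue_on \<Omega>) \<and>
              integrable (lebesgue_on \<Omega>) (\<lambda>x. (norm (u x))\<^sup>2)}"

definition L2_norm :: "(real^'n) set \<Rightarrow> (real^'n \<Rightarrow> real) \<Rightarrow> real" where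
  "L2_norm \<Omega> u = sqrt (LINT x|lebesgue_on \<Omega>. (u x)\<^sup>2)"

definition has_weak_div :: "(real^'n) set \<Rightarrow> (real^'n \<Rightarrow> real^'n) \<Rightarrow> (real^'n \<Rightarrow> real) \<Rightarrow> bool" where
  "has_weak_div \<Omega> v g \<longleftrightarrow> v \<in> L2 \<Omega> \<and> g \<in> L2 \<Omega> \<and>
     (\<forall>\<phi>\<in>test_functions \<Omega>.
        (LINT x|lebesgue_on \<Omega>. v x \<bullet> grad \<phi> x) = - (LINT x|lebesgue_on \<Omega>. g x * \<phi> x))"

definition weak_div :: "(real^'n) set \<Rightarrow> (real^'n \<Rightarrow> real^'n) \<Rightarrow> real^'n \<Rightarrow> real" where
  "weak_div \<Omega> v = (SOME g. has_weak_div \<Omega> v g)"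

definition Hdiv :: "(real^'n) set \<Rightarrow> (real^'n \<Rightarrow> real^'n) set" where
  "Hdiv \<Omega> = {v. \<exists>g. has_weak_div \<Omega> v g}"

definition has_weak_grad :: "(real^'n) set \<Rightarrow> (real^'n \<Rightarrow> real) \<Rightarrow> (real^'n \<Rightarrow> real^'n) \<Rightarrow> bool" where
  "has_weak_grad \<Omega> u G \<longleftrightarrow> u \<in> L2 \<Omega> \<and> G \<in> L2 \<Omega> \<and>
     (\<forall>\<phi>\<in>test_functions \<Omega>.
        (LINT x|lebesgue_on \<Omega>. u x *\<^sub>R grad \<phi> x) = - (LINT x|lebesgue_on \<Omega>. \<phi> x *\<^sub>R G x))"

definition weak_grad :: "(real^'n) set \<Rightarrow> (real^'n \<Rightarrow> real) \<Rightarrow> real^'n \<Rightarrow> real^'n" where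
  "weak_grad \<Omega> u = (SOME G. has_weak_grad \<Omega> u G)"

definition H1 :: "(real^'n) set \<Rightarrow> (real^'n \<Rightarrow> real) set" where
  "H1 \<Omega> = {u. \<exists>G. has_weak_grad \<Omega> u G}"

definition weak_laplacian :: "(real^'n) set \<Rightarrow> (real^'n \<Rightarrow> real) \<Rightarrow> real^'n \<Rightarrow> real" where
  "weak_laplacian \<Omega> u = weak_div \<Omega> (weak_grad \<Omega> u)"

text \<open>The normal trace of a field in \<open>H(div)\<close>, as a functional of the boundary values of \<open>w\<close>. By
  Green's formula it equals the integral of \<open>(v \<bullet> n) * w\<close> over \<open>frontier \<Omega>\<close> for smooth \<open>v\<close>, where
  \<open>n\<close> is the outward unit normal.\<close>

definition normal_trace ::
    "(real^'n) set \<Rightarrow> (real^'n \<Rightarrow> real^'n) \<Rightarrow> (real^'n \<Rightarrow> real) \<Rightarrow> real" where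
  "normal_trace \<Omega> v w =
     (LINT x|lebesgue_on \<Omega>. v x \<bullet> grad w x + weak_div \<Omega> v x * w x)"

text \<open>The condition \<open>v \<bullet> n = 0\<close> on \<open>\<Gamma>\<close>: the normal trace vanishes on all smooth functions that are
  zero near the rest of the boundary.\<close>

definition Hdiv0 :: "(real^'n) set \<Rightarrow> (real^'n) set \<Rightarrow> (real^'n \<Rightarrow> real^'n) set" where
  "Hdiv0 \<Omega> \<Gamma> = {v \<in> Hdiv \<Omega>.
     \<forall>w. smooth w \<and> supp w \<inter> closure (frontier \<Omega> - \<Gamma>) = {} \<longrightarrow> normal_trace \<Omega> v w = 0}"

definition V_space :: "(real^'n) set \<Rightarrow> (real^'n \<Rightarrow> real) set" where
  "V_space \<Omega> = {v \<in> H1 \<Omega>. weak_grad \<Omega> v \<in> Hdiv \<Omega>}"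

definition V_inner :: "(real^'n) set \<Rightarrow> (real^'n \<Rightarrow> real) \<Rightarrow> (real^'n \<Rightarrow> real) \<Rightarrow> real" where
  "V_inner \<Omega> u v = (LINT x|lebesgue_on \<Omega>.
     u x * v x + weak_grad \<Omega> u x \<bullet> weak_grad \<Omega> v x + weak_laplacian \<Omega> u x * weak_laplacian \<Omega> v x)"

definition V_norm :: "(real^'n) set \<Rightarrow> (real^'n \<Rightarrow> real) \<Rightarrow> real" where
  "V_norm \<Omega> v = sqrt (V_inner \<Omega> v v)"

definition bounded_linear_functional_on ::
    "(real^'n \<Rightarrow> real) set \<Rightarrow> ((real^'n \<Rightarrow> real) \<Rightarrow> real) \<Rightarrow> ((real^'n \<Rightarrow> real) \<Rightarrow> real) \<Rightarrow> bool" where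
  "bounded_linear_functional_on X nrm f \<longleftrightarrow>
     (\<forall>u\<in>X. \<forall>v\<in>X. f (\<lambda>x. u x + v x) = f u + f v) \<and>
     (\<forall>c. \<forall>u\<in>X. f (\<lambda>x. c * u x) = c * f u) \<and>
     (\<exists>C. \<forall>u\<in>X. \<bar>f u\<bar> \<le> C * nrm u)"

definition V_dual :: "(real^'n) set \<Rightarrow> ((real^'n \<Rightarrow> real) \<Rightarrow> real) set" where
  "V_dual \<Omega> = {f. bounded_linear_functional_on (V_space \<Omega>) (V_norm \<Omega>) f}"

text \<open>For \<open>f \<in> V_dual \<Omega>\<close>, the integral of \<open>f * \<phi>\<close> denotes the duality pairing \<open>f \<phi>\<close>, at first only for
  \<open>\<phi> \<in> V_space \<Omega>\<close>. The load functional \<open>F\<close> is its continuous extension to all \<open>\<phi> \<in> L2 \<Omega>\<close>. If \<open>f\<close> is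
  given by a function in \<open>L2 \<Omega>\<close>, this is the functional integrating \<open>f * \<phi>\<close>.\<close>

definition load_functional ::
    "(real^'n) set \<Rightarrow> ((real^'n \<Rightarrow> real) \<Rightarrow> real) \<Rightarrow> ((real^'n \<Rightarrow> real) \<Rightarrow> real) \<Rightarrow> bool" where
  "load_functional \<Omega> f F \<longleftrightarrow>
     bounded_linear_functional_on (L2 \<Omega>) (L2_norm \<Omega>) F \<and> (\<forall>v\<in>V_space \<Omega>. F v = f v)"

definition form_a :: "real \<Rightarrow> real \<Rightarrow> (real^'n) set \<Rightarrow>
    (real^'n \<Rightarrow> real) \<times> (real^'n \<Rightarrow> real^'n) \<Rightarrow> (real^'n \<Rightarrow> real) \<times> (real^'n \<Rightarrow> real^'n) \<Rightarrow> real" where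
  "form_a c\<^sub>0 c\<^sub>1 \<Omega> = (\<lambda>(u, v) (\<phi>, \<psi>).
     c\<^sub>0 * (LINT x|lebesgue_on \<Omega>. v x \<bullet> \<psi> x)
     + (LINT x|lebesgue_on \<Omega>. weak_div \<Omega> v x * weak_div \<Omega> \<psi> x)
     + c\<^sub>1 * (LINT x|lebesgue_on \<Omega>. u x * \<phi> x))"

definition form_b :: "(real^'n) set \<Rightarrow>
    (real^'n \<Rightarrow> real) \<times> (real^'n \<Rightarrow> real^'n) \<Rightarrow> (real^'n \<Rightarrow> real^'n) \<Rightarrow> real" where
  "form_b \<Omega> = (\<lambda>(u, v) \<beta>.
     (LINT x|lebesgue_on \<Omega>. \<beta> x \<bullet> v x + u x * weak_div \<Omega> \<beta> x))"

definition saddle_point_solution :: "real \<Rightarrow> real \<Rightarrow> (real^'n) set \<Rightarrow> (real^'n) set \<Rightarrow> (real^'n) set \<Rightarrow>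
    ((real^'n \<Rightarrow> real) \<Rightarrow> real) \<Rightarrow>
    (real^'n \<Rightarrow> real) \<Rightarrow> (real^'n \<Rightarrow> real^'n) \<Rightarrow> (real^'n \<Rightarrow> real^'n) \<Rightarrow> bool" where
  "saddle_point_solution c\<^sub>0 c\<^sub>1 \<Omega> \<Gamma>\<^sub>2 \<Gamma>\<^sub>3 F u v \<alpha> \<longleftrightarrow>
     u \<in> L2 \<Omega> \<and> v \<in> Hdiv0 \<Omega> \<Gamma>\<^sub>3 \<and> \<alpha> \<in> Hdiv0 \<Omega> (\<Gamma>\<^sub>2 \<union> \<Gamma>\<^sub>3) \<and>
     (\<forall>\<phi>\<in>L2 \<Omega>. \<forall>\<psi>\<in>Hdiv0 \<Omega> \<Gamma>\<^sub>3. \<forall>\<beta>\<in>Hdiv0 \<Omega> (\<Gamma>\<^sub>2 \<union> \<Gamma>\<^sub>3).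
        form_a c\<^sub>0 c\<^sub>1 \<Omega> (u, v) (\<phi>, \<psi>) + form_b \<Omega> (\<phi>, \<psi>) \<alpha> = F \<phi> \<and>
        form_b \<Omega> (u, v) \<beta> = 0)"

end

theory Submission
  imports Defs "HOL-Library.Function_Algebras"
begin

text \<open>The form \<open>a\<close> is coercive on all of \<open>L\<^sup>2 \<times> H\<^sub>0(div)\<close>, not only on the kernel of \<open>b\<close>, and \<open>b\<close>
  satisfies the inf-sup condition because every multiplier \<open>\<beta>\<close> yields the admissible pair
  \<open>(div \<beta>, \<beta>)\<close>: the conditions imposed on \<open>\<beta>\<close> contain those imposed on \<open>v\<close>. As \<open>a\<close> is symmetric, it is
  an inner product, and with \<open>B\<close> and \<open>e\<close> representing \<open>b\<close> and \<open>F\<close> in it, the problem reduces to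
  \<open>a (B \<alpha>) (B \<beta>) = b e \<beta>\<close> for all \<open>\<beta>\<close>, again a Riesz representation problem.\<close>

section \<open>Semi-inner product spaces and saddle point problems\<close>

text \<open>Functions that agree almost everywhere are not identified, so the inner products
  involved are degenerate. The Hilbert space arguments are therefore carried out for semi-inner
  products on a carrier set: limits and Riesz representatives exist but are not unique, a map
  choosing representatives need not be linear, and uniqueness means that a difference has seminorm
  0, which becomes equality almost everywhere only at the end. The second obstacle is that
  \<open>weak_div\<close> is a choice. The fundamental lemma of the calculus of variations
  determines it up to null sets, so its linearity is available only under integrals or almost
  everywhere. The boundary conditions are families of integral identities with fixed smooth
  functions; such identities survive limits of the field and its divergence in \<open>L2\<close>,
  which makes \<open>Hdiv0\<close> complete.\<close>

locale semi_inner_space =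
  fixes S :: "'a::real_vector set" and ip :: "'a \<Rightarrow> 'a \<Rightarrow> real"
  assumes subspace: "subspace S"
    and ip_add_left: "\<lbrakk>x \<in> S; y \<in> S; z \<in> S\<rbrakk> \<Longrightarrow> ip (x + y) z = ip x z + ip y z"
    and ip_scale_left: "\<lbrakk>x \<in> S; y \<in> S\<rbrakk> \<Longrightarrow> ip (c *\<^sub>R x) y = c * ip x y"
    and ip_commute: "\<lbrakk>x \<in> S; y \<in> S\<rbrakk> \<Longrightarrow> ip x y = ip y x"
    and ip_nonneg: "x \<in> S \<Longrightarrow> 0 \<le> ip x x"
begin

lemma mem_zero [simp, intro]: "0 \<in> S"
  and mem_add [intro]: "\<lbrakk>x \<in> S; y \<in> S\<rbrakk> \<Longrightarrow> x + y \<in> S"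
  and mem_diff [intro]: "\<lbrakk>x \<in> S; y \<in> S\<rbrakk> \<Longrightarrow> x - y \<in> S"
  and mem_scale [intro]: "x \<in> S \<Longrightarrow> c *\<^sub>R x \<in> S"
  using subspace by (auto intro: subspace_0 subspace_add subspace_diff subspace_scale)

lemma ip_add_right: "\<lbrakk>x \<in> S; y \<in> S; z \<in> S\<rbrakk> \<Longrightarrow> ip x (y + z) = ip x y + ip x z"
  by (metis ip_add_left ip_commute mem_add)

lemma ip_scale_right: "\<lbrakk>x \<in> S; y \<in> S\<rbrakk> \<Longrightarrow> ip x (c *\<^sub>R y) = c * ip x y"
  by (metis ip_scale_left ip_commute mem_scale)

lemma ip_diff_left: "\<lbrakk>x \<in> S; y \<in> S; z \<in> S\<rbrakk> \<Longrightarrow> ip (x - y) z = ip x z - ip y z"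
  using ip_add_left[of x "(-1) *\<^sub>R y" z] ip_scale_left[of y z "-1"] mem_scale[of y "-1"] by simp

lemma ip_diff_right: "\<lbrakk>x \<in> S; y \<in> S; z \<in> S\<rbrakk> \<Longrightarrow> ip x (y - z) = ip x y - ip x z"
  by (metis ip_diff_left ip_commute mem_diff)

lemmas ip_simps = ip_add_left ip_add_right ip_diff_left ip_diff_right ip_scale_left ip_scale_right
  mem_add mem_diff mem_scale

text \<open>For a null vector \<open>y\<close> the usual minimising parameter does not exist; the
  quadratic in \<open>t\<close> is then affine and stays nonnegative only if its slope
  vanishes.\<close>

lemma Cauchy_Schwarz:
  assumes x: "x \<in> S" and y: "y \<in> S"
  shows "\<bar>ip x y\<bar> \<le> sqrt (ip x x) * sqrt (ip y y)"
proof -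
  have q: "0 \<le> ip x x + 2 * t * ip x y + t\<^sup>2 * ip y y" for t
    using ip_nonneg[of "x + t *\<^sub>R y"] x y ip_commute[OF y x]
    by (simp add: ip_simps power2_eq_square algebra_simps)
  have "(ip x y)\<^sup>2 \<le> ip x x * ip y y"
  proof (cases "ip y y = 0")
    case True
    have "ip x y = 0"
    proof (rule ccontr)
      assume n: "ip x y \<noteq> 0"
      \<comment> \<open>At this \<open>t\<close> the affine function takes the value -1.\<close>
      show False
        using q[of "- (ip x x + 1) / (2 * ip x y)"] n True by (simp add: field_simps)
    qed
    then show ?thesis using True by simp
  next
    case False
    then have p: "ip y y > 0" using ip_nonneg[OF y] by simp
    have "0 \<le> ip x x - (ip x y)\<^sup>2 / ip y y"
      using q[of "- ip x y / ip y y"] p by (simp add: field_simps power2_eq_square)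
    then show ?thesis using p by (simp add: field_simps)
  qed
  then have "sqrt ((ip x y)\<^sup>2) \<le> sqrt (ip x x * ip y y)" by (rule real_sqrt_le_mono)
  then show ?thesis by (simp add: real_sqrt_mult)
qed

text \<open>Cauchy-Schwarz makes the pairing with a fixed vector continuous. The limit
  \<open>x\<close> is determined only up to null vectors, on which the pairing vanishes.\<close>

lemma tendsto_ip:
  assumes X: "\<And>n. X n \<in> S" and x: "x \<in> S" and y: "y \<in> S"
    and lim: "(\<lambda>n. ip (X n - x) (X n - x)) \<longlonglongrightarrow> 0"
  shows "(\<lambda>n. ip (X n) y) \<longlonglongrightarrow> ip x y"
proof -
  have "(\<lambda>n. sqrt (ip (X n - x) (X n - x)) * sqrt (ip y y)) \<longlonglongrightarrow> sqrt 0 * sqrt (ip y y)"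
    by (intro tendsto_intros lim)
  then have 1: "(\<lambda>n. sqrt (ip (X n - x) (X n - x)) * sqrt (ip y y)) \<longlonglongrightarrow> 0" by simp
  have 2: "\<forall>\<^sub>F n in sequentially. norm (ip (X n) y - ip x y) \<le> sqrt (ip (X n - x) (X n - x)) * sqrt (ip y y)"
    using Cauchy_Schwarz[of "X n - x" y for n] X x y by (simp add: ip_simps)
  show ?thesis using Lim_null_comparison[OF 2 1] by (simp add: LIM_zero_iff)
qed

end

section \<open>Completeness and Riesz representation\<close>

locale semi_hilbert_space = semi_inner_space +
  assumes complete: "\<lbrakk>\<And>n. X n \<in> S;
      \<And>e. e > 0 \<Longrightarrow> \<exists>N::nat. \<forall>m\<ge>N. \<forall>n\<ge>N. ip (X m - X n) (X m - X n) < e\<rbrakk>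
    \<Longrightarrow> \<exists>x\<in>S. (\<lambda>n. ip (X n - x) (X n - x)) \<longlonglongrightarrow> 0"
begin

text \<open>Direct method: the representative minimises the energy \<open>J\<close>. Degenerate
  directions cause no trouble, since the bound on \<open>l\<close> forces it to vanish on null
  vectors.\<close>

theorem Riesz_representation:
  assumes add: "\<And>x y. \<lbrakk>x \<in> S; y \<in> S\<rbrakk> \<Longrightarrow> l (x + y) = l x + l y"
    and scale: "\<And>c x. x \<in> S \<Longrightarrow> l (c *\<^sub>R x) = c * l x"
    and bound: "\<And>x. x \<in> S \<Longrightarrow> \<bar>l x\<bar> \<le> C * sqrt (ip x x)"
  shows "\<exists>x\<in>S. \<forall>y\<in>S. ip x y = l y"
proof -
  define J where "J x = ip x x - 2 * l x" for x
  have J_bound: "- (C\<^sup>2) \<le> J x" if "x \<in> S" for x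
  proof -
    have "0 \<le> (sqrt (ip x x) - C)\<^sup>2" by simp
    also have "\<dots> = ip x x - 2 * (C * sqrt (ip x x)) + C\<^sup>2"
      using ip_nonneg[OF that] by (simp add: power2_diff)
    finally show ?thesis using bound[OF that] unfolding J_def by linarith
  qed
  define d where "d = Inf (J ` S)"
  have bdd: "bdd_below (J ` S)" using J_bound by (auto simp: bdd_below_def)
  have d_le: "d \<le> J x" if "x \<in> S" for x unfolding d_def by (rule cINF_lower[OF bdd that])
  have "\<exists>x\<in>S. J x < d + inverse (Suc n)" for n
    using cInf_lessD[of "J ` S" "d + inverse (Suc n)"] unfolding d_def by (auto simp: ex_in_conv[symmetric])
  then obtain X where X: "\<And>n. X n \<in> S" and JX: "\<And>n. J (X n) < d + inverse (Suc n)" by metis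
  \<comment> \<open>Parallelogram law: the linear parts cancel and the midpoint has energy at least
    \<open>d\<close>, so a minimising sequence is Cauchy.\<close>
  have "ip (X m - X n) (X m - X n) \<le> 2 * inverse (Suc m) + 2 * inverse (Suc n)" for m n
  proof -
    have "ip (X m - X n) (X m - X n)
        = 2 * J (X m) + 2 * J (X n) - 4 * J ((1/2) *\<^sub>R (X m + X n))"
      using X[of m] X[of n] unfolding J_def
      by (simp add: ip_simps add scale ip_commute[OF X[of n] X[of m]] algebra_simps)
    then show ?thesis using JX[of m] JX[of n] d_le[of "(1/2) *\<^sub>R (X m + X n)"] X by (smt (verit) mem_add mem_scale)
  qed
  note close = this
  have "\<exists>x\<in>S. (\<lambda>n. ip (X n - x) (X n - x)) \<longlonglongrightarrow> 0"
  proof (rule complete[OF X])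
    fix e :: real assume "e > 0"
    then obtain N where N: "inverse (real (Suc N)) < e / 4"
      using reals_Archimedean[of "e/4"] by auto
    have "ip (X m - X n) (X m - X n) < e" if "m \<ge> N" "n \<ge> N" for m n
    proof -
      have "inverse (real (Suc m)) \<le> inverse (real (Suc N))" "inverse (real (Suc n)) \<le> inverse (real (Suc N))"
        using that by (auto intro: le_imp_inverse_le)
      then show ?thesis using close[of m n] N by linarith
    qed
    then show "\<exists>N. \<forall>m\<ge>N. \<forall>n\<ge>N. ip (X m - X n) (X m - X n) < e" by blast
  qed
  then obtain x where x: "x \<in> S" and lim: "(\<lambda>n. ip (X n - x) (X n - x)) \<longlonglongrightarrow> 0" by blast
  have "ip x y = l y" if y: "y \<in> S" for y
  proof -
    \<comment> \<open>Minimality is expanded at \<open>X n\<close> before passing to the limit, so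
      that only pairings with \<open>y\<close> have to converge and not the energies.\<close>
    have q: "0 \<le> 2 * t * (ip x y - l y) + t\<^sup>2 * ip y y" for t
    proof (rule LIMSEQ_le)
      show "(\<lambda>n. - inverse (real (Suc n))) \<longlonglongrightarrow> 0"
        using tendsto_minus[OF LIMSEQ_inverse_real_of_nat] by simp
      show "(\<lambda>n. 2 * t * (ip (X n) y - l y) + t\<^sup>2 * ip y y)
          \<longlonglongrightarrow> 2 * t * (ip x y - l y) + t\<^sup>2 * ip y y"
        by (intro tendsto_intros tendsto_ip[OF X x y lim])
      have "- inverse (real (Suc n)) \<le> 2 * t * (ip (X n) y - l y) + t\<^sup>2 * ip y y" for n
      proof -
        have "J (X n + t *\<^sub>R y) = J (X n) + 2 * t * (ip (X n) y - l y) + t\<^sup>2 * ip y y"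
          using X[of n] y unfolding J_def
          by (simp add: ip_simps add scale ip_commute[OF y X] power2_eq_square algebra_simps)
        moreover have "d \<le> J (X n + t *\<^sub>R y)" using d_le X y by blast
        ultimately show ?thesis using JX[of n] by linarith
      qed
      then show "\<exists>N. \<forall>n\<ge>N. - inverse (real (Suc n)) \<le> 2 * t * (ip (X n) y - l y) + t\<^sup>2 * ip y y"
        by blast
    qed
    define D where "D = ip x y - l y"
    \<comment> \<open>Adding 1 keeps \<open>K\<close> positive for null \<open>y\<close>; the
      parameter \<open>- D / K\<close> then pushes the quadratic down to at most
      \<open>- (D\<^sup>2 / K)\<close>.\<close>
    define K where "K = ip y y + 1"
    have K: "K > 0" "ip y y < K" using ip_nonneg[OF y] by (auto simp: K_def)
    have "0 \<le> 2 * (- D / K) * D + (- D / K)\<^sup>2 * ip y y" using q[of "- D / K"] by (simp add: D_def)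
    also have "\<dots> \<le> 2 * (- D / K) * D + (- D / K)\<^sup>2 * K"
      using K by (intro add_left_mono mult_left_mono) auto
    also have "\<dots> = - (D\<^sup>2 / K)" using K by (simp add: field_simps power2_eq_square)
    finally have "D = 0" using K by (simp add: field_simps zero_le_divide_iff)
    then show ?thesis by (simp add: D_def)
  qed
  then show ?thesis using x by blast
qed

text \<open>Equivalent seminorms have the same Cauchy sequences and limits. Both the form
  \<open>a\<close> and the reduced form on the multipliers inherit completeness in this way.\<close>

lemma semi_hilbert_space_equivalent:
  assumes "semi_inner_space S ip'"
    and le: "\<And>x. x \<in> S \<Longrightarrow> ip' x x \<le> C * ip x x" and ge: "\<And>x. x \<in> S \<Longrightarrow> ip x x \<le> K * ip' x x"
  shows "semi_hilbert_space S ip'"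
proof -
  interpret p: semi_inner_space S ip' by fact
  show ?thesis
  proof unfold_locales
    fix X :: "nat \<Rightarrow> 'a" assume X: "\<And>n. X n \<in> S"
      and cau: "\<And>e. e > 0 \<Longrightarrow> \<exists>N::nat. \<forall>m\<ge>N. \<forall>n\<ge>N. ip' (X m - X n) (X m - X n) < e"
    \<comment> \<open>The constant \<open>K\<close> may be nonpositive, while the argument divides
      by it.\<close>
    define K' where "K' = \<bar>K\<bar> + 1"
    have K': "K' > 0" "ip x x \<le> K' * ip' x x" if "x \<in> S" for x
    proof -
      show "K' > 0" by (simp add: K'_def)
      have "K * ip' x x \<le> K' * ip' x x" using p.ip_nonneg[OF that] by (intro mult_right_mono) (auto simp: K'_def)
      then show "ip x x \<le> K' * ip' x x" using ge[OF that] by linarith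
    qed
    have "\<exists>x\<in>S. (\<lambda>n. ip (X n - x) (X n - x)) \<longlonglongrightarrow> 0"
    proof (rule complete[OF X])
      fix e :: real assume "e > 0"
      then obtain N where N: "\<forall>m\<ge>N. \<forall>n\<ge>N. ip' (X m - X n) (X m - X n) < e / K'"
        using cau[of "e / K'"] K'(1)[OF mem_zero] by auto
      have "ip (X m - X n) (X m - X n) < e" if "m \<ge> N" "n \<ge> N" for m n
      proof -
        have "ip (X m - X n) (X m - X n) \<le> K' * ip' (X m - X n) (X m - X n)" using K'(2) X by blast
        also have "\<dots> < e" using N that K'(1)[OF mem_zero] by (simp add: pos_less_divide_eq mult.commute)
        finally show ?thesis .
      qed
      then show "\<exists>N. \<forall>m\<ge>N. \<forall>n\<ge>N. ip (X m - X n) (X m - X n) < e" by blast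
    qed
    then obtain x where x: "x \<in> S" and lim: "(\<lambda>n. ip (X n - x) (X n - x)) \<longlonglongrightarrow> 0" by blast
    have "(\<lambda>n. ip' (X n - x) (X n - x)) \<longlonglongrightarrow> 0"
    proof (rule tendsto_sandwich)
      show "\<forall>\<^sub>F n in sequentially. 0 \<le> ip' (X n - x) (X n - x)"
        using X x by (intro always_eventually allI p.ip_nonneg) auto
      show "\<forall>\<^sub>F n in sequentially. ip' (X n - x) (X n - x) \<le> C * ip (X n - x) (X n - x)"
        using X x by (intro always_eventually allI le) auto
      show "(\<lambda>n. C * ip (X n - x) (X n - x)) \<longlonglongrightarrow> 0" using tendsto_mult_right_zero[OF lim] by simp
    qed simp
    then show "\<exists>x\<in>S. (\<lambda>n. ip' (X n - x) (X n - x)) \<longlonglongrightarrow> 0" using x by blast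
  qed
qed

end

section \<open>Abstract saddle point problems\<close>

lemma sqrt_quadratic_le:
  fixes A p M :: real
  assumes "A \<ge> 0" "p \<ge> 0" "A \<le> M * sqrt A * sqrt p"
  shows "A \<le> M\<^sup>2 * p"
proof (cases "A = 0")
  case True then show ?thesis using assms by simp
next
  case False
  then have s: "sqrt A > 0" using assms by simp
  have "sqrt A * sqrt A \<le> (M * sqrt p) * sqrt A" using assms by (simp add: ac_simps)
  then have *: "sqrt A \<le> M * sqrt p" using s mult_le_cancel_right by (metis not_less)
  have "(sqrt A)\<^sup>2 \<le> (M * sqrt p)\<^sup>2" using * s by (intro power_mono) auto
  then show ?thesis using assms by (simp add: power_mult_distrib)
qed

text \<open>The reduced form \<open>A\<close> is the Schur complement of the system. Boundedness of
  \<open>b\<close> bounds it above by \<open>p\<close>, and the inf-sup condition, stated as one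
  controlled test vector for each \<open>y\<close>, bounds it below; so \<open>A\<close> inherits
  completeness from \<open>p\<close>.\<close>

theorem saddle_point_existence:
  fixes a :: "'a::real_vector \<Rightarrow> 'a \<Rightarrow> real" and p :: "'b::real_vector \<Rightarrow> 'b \<Rightarrow> real"
  assumes "semi_hilbert_space X a" "semi_hilbert_space Y p"
    and b_add_left: "\<And>x x' y. \<lbrakk>x \<in> X; x' \<in> X; y \<in> Y\<rbrakk> \<Longrightarrow> b (x + x') y = b x y + b x' y"
    and b_scale_left: "\<And>c x y. \<lbrakk>x \<in> X; y \<in> Y\<rbrakk> \<Longrightarrow> b (c *\<^sub>R x) y = c * b x y"
    and b_add_right: "\<And>x y y'. \<lbrakk>x \<in> X; y \<in> Y; y' \<in> Y\<rbrakk> \<Longrightarrow> b x (y + y') = b x y + b x y'"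
    and b_scale_right: "\<And>c x y. \<lbrakk>x \<in> X; y \<in> Y\<rbrakk> \<Longrightarrow> b x (c *\<^sub>R y) = c * b x y"
    and b_bound: "\<And>x y. \<lbrakk>x \<in> X; y \<in> Y\<rbrakk> \<Longrightarrow> \<bar>b x y\<bar> \<le> M * sqrt (a x x) * sqrt (p y y)"
    and inf_sup: "\<And>y. y \<in> Y \<Longrightarrow> \<exists>x\<in>X. a x x \<le> K * p y y \<and> p y y \<le> b x y"
    and l_add: "\<And>x x'. \<lbrakk>x \<in> X; x' \<in> X\<rbrakk> \<Longrightarrow> l (x + x') = l x + l x'"
    and l_scale: "\<And>c x. x \<in> X \<Longrightarrow> l (c *\<^sub>R x) = c * l x"
    and l_bound: "\<And>x. x \<in> X \<Longrightarrow> \<bar>l x\<bar> \<le> C * sqrt (a x x)"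
  shows "\<exists>x\<in>X. \<exists>y\<in>Y. (\<forall>x'\<in>X. a x x' + b x' y = l x') \<and> (\<forall>y'\<in>Y. b x y' = 0)"
proof -
  interpret a: semi_hilbert_space X a by fact
  interpret p: semi_hilbert_space Y p by fact
  have "\<forall>y\<in>Y. \<exists>z\<in>X. \<forall>x\<in>X. a z x = b x y"
  proof
    fix y assume y: "y \<in> Y"
    show "\<exists>z\<in>X. \<forall>x\<in>X. a z x = b x y"
      by (rule a.Riesz_representation[where C = "M * sqrt (p y y)"])
        (use y b_bound in \<open>auto simp: b_add_left b_scale_left ac_simps\<close>)
  qed
  then obtain B where B: "\<And>y. y \<in> Y \<Longrightarrow> B y \<in> X"
    and aB: "\<And>x y. \<lbrakk>x \<in> X; y \<in> Y\<rbrakk> \<Longrightarrow> a (B y) x = b x y" by metis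
  define A where "A y y' = a (B y) (B y')" for y y'
  \<comment> \<open>Riesz representatives are unique only up to null vectors, so the chosen
    \<open>B\<close> need not be linear. Linearity of \<open>A\<close> is read off from
    \<open>b\<close> through this identity, its symmetry from \<open>a\<close>.\<close>
  have A_b: "A y y' = b (B y') y" if "y \<in> Y" "y' \<in> Y" for y y'
    using that aB B by (simp add: A_def)
  interpret A: semi_inner_space Y A
  proof
    show "subspace Y" by (rule p.subspace)
    show "A (x + y) z = A x z + A y z" if "x \<in> Y" "y \<in> Y" "z \<in> Y" for x y z
      using b_add_right[OF B[OF that(3)] that(1,2)] A_b[OF _ that(3)] that p.mem_add[OF that(1,2)] by simp
    show "A (c *\<^sub>R x) y = c * A x y" if "x \<in> Y" "y \<in> Y" for x y c
      using b_scale_right[OF B[OF that(2)] that(1)] A_b[OF _ that(2)] that p.mem_scale[OF that(1)] by simp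
    show "A y y' = A y' y" if "y \<in> Y" "y' \<in> Y" for y y'
      using that B by (simp add: A_def a.ip_commute)
    show "0 \<le> A y y" if "y \<in> Y" for y
      using that B by (simp add: A_def a.ip_nonneg)
  qed
  have "semi_hilbert_space Y A"
  proof (rule p.semi_hilbert_space_equivalent)
    show "semi_inner_space Y A" by unfold_locales
    fix y assume y: "y \<in> Y"
    \<comment> \<open>Boundedness is used at the point \<open>B y\<close>, where
      \<open>b (B y) y\<close> equals \<open>A y y\<close>; one factor \<open>sqrt (A y y)\<close>
      then cancels.\<close>
    have "A y y \<le> M * sqrt (A y y) * sqrt (p y y)"
      using b_bound[OF B[OF y] y] y by (simp add: A_b[OF y y, symmetric] A_def[symmetric])
    then show "A y y \<le> M\<^sup>2 * p y y"
      by (intro sqrt_quadratic_le A.ip_nonneg p.ip_nonneg y)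
    obtain x where x: "x \<in> X" "a x x \<le> K * p y y" "p y y \<le> b x y" using inf_sup[OF y] by blast
    have Kp: "K * p y y \<ge> 0" using x a.ip_nonneg[of x] by linarith
    \<comment> \<open>The inf-sup vector \<open>x\<close> is paired with \<open>B y\<close>, and
      Cauchy-Schwarz for \<open>a\<close> brings in \<open>A\<close>.\<close>
    have "p y y \<le> a (B y) x" using aB x y by simp
    also have "\<dots> \<le> sqrt (A y y) * sqrt (a x x)" using a.Cauchy_Schwarz[of "B y" x] B y x by (simp add: A_def)
    also have "\<dots> \<le> sqrt (A y y) * sqrt (K * p y y)" using x A.ip_nonneg[OF y] by (intro mult_left_mono) auto
    also have "\<dots> = sqrt K * sqrt (p y y) * sqrt (A y y)" by (simp add: real_sqrt_mult)
    finally have *: "p y y \<le> sqrt K * sqrt (p y y) * sqrt (A y y)" .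
    show "p y y \<le> (sqrt K)\<^sup>2 * A y y"
      by (intro sqrt_quadratic_le A.ip_nonneg p.ip_nonneg y *)
  qed
  then interpret A: semi_hilbert_space Y A .
  have "\<exists>e\<in>X. \<forall>x\<in>X. a e x = l x"
    by (rule a.Riesz_representation[OF l_add l_scale l_bound])
  then obtain e where e: "e \<in> X" and ae: "\<And>x. x \<in> X \<Longrightarrow> a e x = l x" by blast
  have "\<exists>y\<in>Y. \<forall>y'\<in>Y. A y y' = b e y'"
  proof (rule A.Riesz_representation[where C = "sqrt (a e e)"])
    \<comment> \<open>As \<open>b e y\<close> is \<open>a (B y) e\<close>, Cauchy-Schwarz for
      \<open>a\<close> bounds it directly in the seminorm of \<open>A\<close>.\<close>
    show "\<bar>b e y\<bar> \<le> sqrt (a e e) * sqrt (A y y)" if y: "y \<in> Y" for y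
      using a.Cauchy_Schwarz[OF B[OF y] e] aB[OF e y] by (simp add: A_def ac_simps)
  qed (use e in \<open>auto simp: b_add_right b_scale_right\<close>)
  then obtain y where y: "y \<in> Y" and Ay: "\<And>y'. y' \<in> Y \<Longrightarrow> A y y' = b e y'" by blast
  \<comment> \<open>The first equation determines the primal unknown from the multiplier:
    \<open>e\<close> represents the load and \<open>B y\<close> the coupling term.\<close>
  have "a (e - B y) x' + b x' y = l x'" if "x' \<in> X" for x'
    using that e B[OF y] ae aB[OF that y] by (simp add: a.ip_diff_left)
  moreover have "b (e - B y) y' = 0" if y': "y' \<in> Y" for y'
  proof -
    have "b (e - B y) y' = a (B y') (e - B y)" using aB[OF a.mem_diff[OF e B[OF y]] y'] by simp
    also have "\<dots> = b e y' - A y' y" using e B[OF y] B[OF y'] aB[OF e y'] by (simp add: a.ip_diff_right A_def)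
    also have "\<dots> = 0" using Ay[OF y'] A.ip_commute[OF y y'] by simp
    finally show ?thesis .
  qed
  ultimately show ?thesis using e B[OF y] y by blast
qed

text \<open>Testing the difference with itself only kills its \<open>a\<close>-seminorm. By
  Cauchy-Schwarz it is then orthogonal to all of \<open>X\<close>, so \<open>b\<close> vanishes at
  the difference of the multipliers, and the inf-sup condition makes that one null too.\<close>

theorem saddle_point_uniqueness:
  fixes a :: "'a::real_vector \<Rightarrow> 'a \<Rightarrow> real" and p :: "'b::real_vector \<Rightarrow> 'b \<Rightarrow> real"
  assumes "semi_inner_space X a" "semi_inner_space Y p"
    and b_add_left: "\<And>x x' y. \<lbrakk>x \<in> X; x' \<in> X; y \<in> Y\<rbrakk> \<Longrightarrow> b (x + x') y = b x y + b x' y"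
    and b_add_right: "\<And>x y y'. \<lbrakk>x \<in> X; y \<in> Y; y' \<in> Y\<rbrakk> \<Longrightarrow> b x (y + y') = b x y + b x y'"
    and inf_sup: "\<And>y. y \<in> Y \<Longrightarrow> \<exists>x\<in>X. a x x \<le> K * p y y \<and> p y y \<le> b x y"
    and mem: "x\<^sub>1 \<in> X" "x\<^sub>2 \<in> X" "y\<^sub>1 \<in> Y" "y\<^sub>2 \<in> Y"
    and eqs: "\<And>x'. x' \<in> X \<Longrightarrow> a x\<^sub>1 x' + b x' y\<^sub>1 = a x\<^sub>2 x' + b x' y\<^sub>2"
      "\<And>y'. y' \<in> Y \<Longrightarrow> b x\<^sub>1 y' = b x\<^sub>2 y'"
  shows "a (x\<^sub>1 - x\<^sub>2) (x\<^sub>1 - x\<^sub>2) = 0 \<and> p (y\<^sub>1 - y\<^sub>2) (y\<^sub>1 - y\<^sub>2) = 0"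
proof -
  interpret a: semi_inner_space X a by fact
  interpret p: semi_inner_space Y p by fact
  have dx: "x\<^sub>1 - x\<^sub>2 \<in> X" and dy: "y\<^sub>1 - y\<^sub>2 \<in> Y" using mem by blast+
  have b_dx: "b (x\<^sub>1 - x\<^sub>2) y = b x\<^sub>1 y - b x\<^sub>2 y" if "y \<in> Y" for y
    using b_add_left[OF dx mem(2) that] by simp
  have b_dy: "b x (y\<^sub>1 - y\<^sub>2) = b x y\<^sub>1 - b x y\<^sub>2" if "x \<in> X" for x
    using b_add_right[OF that dy mem(4)] by simp
  have 1: "a (x\<^sub>1 - x\<^sub>2) x + b x (y\<^sub>1 - y\<^sub>2) = 0" if "x \<in> X" for x
    using eqs(1)[OF that] that mem by (simp add: a.ip_diff_left b_dy)
  have "b (x\<^sub>1 - x\<^sub>2) (y\<^sub>1 - y\<^sub>2) = 0" using eqs(2)[OF dy] b_dx[OF dy] by simp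
  then have a0: "a (x\<^sub>1 - x\<^sub>2) (x\<^sub>1 - x\<^sub>2) = 0" using 1[OF dx] by simp
  obtain x where x: "x \<in> X" "p (y\<^sub>1 - y\<^sub>2) (y\<^sub>1 - y\<^sub>2) \<le> b x (y\<^sub>1 - y\<^sub>2)" using inf_sup[OF dy] by blast
  have "a (x\<^sub>1 - x\<^sub>2) x = 0" using a.Cauchy_Schwarz[OF dx x(1)] a0 by simp
  then have "p (y\<^sub>1 - y\<^sub>2) (y\<^sub>1 - y\<^sub>2) \<le> 0" using 1[OF x(1)] x(2) by simp
  then show ?thesis using a0 p.ip_nonneg[OF dy] by simp
qed

section \<open>Products of complete spaces\<close>

lemma semi_hilbert_space_Times:
  assumes "semi_hilbert_space S p" "semi_hilbert_space T q"
  shows "semi_hilbert_space (S \<times> T) (\<lambda>x y. p (fst x) (fst y) + q (snd x) (snd y))"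
proof -
  interpret p: semi_hilbert_space S p by fact
  interpret q: semi_hilbert_space T q by fact
  show ?thesis
  proof
    show "subspace (S \<times> T)" by (intro subspace_Times p.subspace q.subspace)
  next
    fix X :: "nat \<Rightarrow> 'a \<times> 'b"
    assume X: "\<And>n. X n \<in> S \<times> T"
      and cau: "\<And>e. e > 0 \<Longrightarrow> \<exists>N::nat. \<forall>m\<ge>N. \<forall>n\<ge>N. p (fst (X m - X n)) (fst (X m - X n))
        + q (snd (X m - X n)) (snd (X m - X n)) < e"
    have mem: "fst (X n) \<in> S" "snd (X n) \<in> T" for n using X[of n] by auto
    have pos: "0 \<le> p (fst (X m) - fst (X n)) (fst (X m) - fst (X n))"
      "0 \<le> q (snd (X m) - snd (X n)) (snd (X m) - snd (X n))" for m n
      using mem by (auto intro!: p.ip_nonneg q.ip_nonneg)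
    have "\<exists>x\<in>S. (\<lambda>n. p (fst (X n) - x) (fst (X n) - x)) \<longlonglongrightarrow> 0"
    proof (rule p.complete[OF mem(1)])
      fix e :: real assume "e > 0"
      then obtain N where N: "\<And>m n. m \<ge> N \<Longrightarrow> n \<ge> N \<Longrightarrow> p (fst (X m - X n)) (fst (X m - X n))
        + q (snd (X m - X n)) (snd (X m - X n)) < e" using cau by meson
      have "p (fst (X m) - fst (X n)) (fst (X m) - fst (X n)) < e" if "m \<ge> N" "n \<ge> N" for m n
        using N[OF that] pos[of m n] by simp
      then show "\<exists>N. \<forall>m\<ge>N. \<forall>n\<ge>N. p (fst (X m) - fst (X n)) (fst (X m) - fst (X n)) < e" by blast
    qed
    moreover have "\<exists>y\<in>T. (\<lambda>n. q (snd (X n) - y) (snd (X n) - y)) \<longlonglongrightarrow> 0"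
    proof (rule q.complete[OF mem(2)])
      fix e :: real assume "e > 0"
      then obtain N where N: "\<And>m n. m \<ge> N \<Longrightarrow> n \<ge> N \<Longrightarrow> p (fst (X m - X n)) (fst (X m - X n))
        + q (snd (X m - X n)) (snd (X m - X n)) < e" using cau by meson
      have "q (snd (X m) - snd (X n)) (snd (X m) - snd (X n)) < e" if "m \<ge> N" "n \<ge> N" for m n
        using N[OF that] pos[of m n] by simp
      then show "\<exists>N. \<forall>m\<ge>N. \<forall>n\<ge>N. q (snd (X m) - snd (X n)) (snd (X m) - snd (X n)) < e" by blast
    qed
    ultimately obtain x y where "x \<in> S" "y \<in> T"
      "(\<lambda>n. p (fst (X n) - x) (fst (X n) - x)) \<longlonglongrightarrow> 0" "(\<lambda>n. q (snd (X n) - y) (snd (X n) - y)) \<longlonglongrightarrow> 0"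
      by blast
    then show "\<exists>z\<in>S \<times> T. (\<lambda>n. p (fst (X n - z)) (fst (X n - z)) + q (snd (X n - z)) (snd (X n - z))) \<longlonglongrightarrow> 0"
      by (intro bexI[of _ "(x, y)"]) (auto intro: tendsto_add_zero)
  qed (auto simp: p.ip_add_left q.ip_add_left p.ip_scale_left q.ip_scale_left
      p.ip_commute q.ip_commute p.ip_nonneg q.ip_nonneg algebra_simps)
qed

section \<open>Square integrable functions\<close>

text \<open>Pointwise scaling makes functions a real vector space, so that the spaces of the problem
  are subspaces in the sense of the abstract locales.\<close>

instantiation "fun" :: (type, real_vector) real_vector
begin

definition "c *\<^sub>R f = (\<lambda>x. c *\<^sub>R f x)"

instance
  by standard (simp_all add: scaleR_fun_def fun_eq_iff scaleR_add_right scaleR_add_left)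

end

lemma scaleR_fun_apply [simp]: "(c *\<^sub>R f) x = c *\<^sub>R f x"
  by (simp add: scaleR_fun_def)

text \<open>General in the measure and the codomain, so that scalar functions and vector fields
  share one completeness proof.\<close>

definition square_integrable :: "'a measure \<Rightarrow> ('a \<Rightarrow> 'b::euclidean_space) set" where
  "square_integrable M = {u. u \<in> borel_measurable M \<and> integrable M (\<lambda>x. (norm (u x))\<^sup>2)}"

definition L2_ip :: "'a measure \<Rightarrow> ('a \<Rightarrow> 'b::euclidean_space) \<Rightarrow> ('a \<Rightarrow> 'b) \<Rightarrow> real" where
  "L2_ip M u v = (LINT x|M. u x \<bullet> v x)"

lemma square_integrable_measurable: "u \<in> square_integrable M \<Longrightarrow> u \<in> borel_measurable M"
  by (simp add: square_integrable_def)

lemma L2_eq: "L2 \<Omega> = square_integrable (lebesgue_on \<Omega>)"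
  by (simp add: L2_def square_integrable_def)

lemma L2_ip_self: "L2_ip M u u = (LINT x|M. (norm (u x))\<^sup>2)"
  by (simp add: L2_ip_def power2_norm_eq_inner)

lemma integrable_inner:
  assumes "u \<in> square_integrable M" "v \<in> square_integrable M"
  shows "integrable M (\<lambda>x. u x \<bullet> v x)"
proof (rule Bochner_Integration.integrable_bound)
  show "integrable M (\<lambda>x. (norm (u x))\<^sup>2 + (norm (v x))\<^sup>2)"
    using assms by (auto simp: square_integrable_def)
  show "(\<lambda>x. u x \<bullet> v x) \<in> borel_measurable M"
    using assms by (auto simp: square_integrable_def)
  have "\<bar>u x \<bullet> v x\<bar> \<le> (norm (u x))\<^sup>2 + (norm (v x))\<^sup>2" for x
  proof -
    have "\<bar>u x \<bullet> v x\<bar> \<le> norm (u x) * norm (v x)" by (rule Cauchy_Schwarz_ineq2)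
    also have "\<dots> \<le> (norm (u x))\<^sup>2 + (norm (v x))\<^sup>2"
      using sum_squares_bound[of "norm (u x)" "norm (v x)"] mult_nonneg_nonneg[OF norm_ge_zero norm_ge_zero, of "u x" "v x"]
      by linarith
    finally show ?thesis .
  qed
  then show "AE x in M. norm (u x \<bullet> v x) \<le> norm ((norm (u x))\<^sup>2 + (norm (v x))\<^sup>2)"
    by simp
qed

lemma subspace_square_integrable: "subspace (square_integrable M)"
proof (rule subspaceI)
  show "0 \<in> square_integrable M" by (auto simp: square_integrable_def zero_fun_def)
next
  fix u v :: "'a \<Rightarrow> 'b" assume uv: "u \<in> square_integrable M" "v \<in> square_integrable M"
  have "integrable M (\<lambda>x. (norm (u x))\<^sup>2 + 2 * (u x \<bullet> v x) + (norm (v x))\<^sup>2)"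
    using uv integrable_inner[OF uv] by (auto simp: square_integrable_def)
  also have "(\<lambda>x. (norm (u x))\<^sup>2 + 2 * (u x \<bullet> v x) + (norm (v x))\<^sup>2) = (\<lambda>x. (norm ((u + v) x))\<^sup>2)"
    by (simp add: power2_norm_eq_inner inner_add_left inner_add_right inner_commute fun_eq_iff)
  finally show "u + v \<in> square_integrable M"
    using uv by (auto simp: square_integrable_def plus_fun_def)
next
  fix c and u :: "'a \<Rightarrow> 'b" assume "u \<in> square_integrable M"
  then show "c *\<^sub>R u \<in> square_integrable M"
    by (auto simp: square_integrable_def scaleR_fun_def power_mult_distrib)
qed

interpretation L2_space: semi_inner_space "square_integrable M" "L2_ip M" for M
proof
  show "subspace (square_integrable M)" by (rule subspace_square_integrable)
  show "L2_ip M (x + y) z = L2_ip M x z + L2_ip M y z"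
    if "x \<in> square_integrable M" "y \<in> square_integrable M" "z \<in> square_integrable M" for x y z
    using that by (simp add: L2_ip_def inner_add_left integrable_inner)
qed (auto simp: L2_ip_def inner_commute intro: integral_nonneg_AE)

section \<open>Completeness of the square integrable functions\<close>

lemma L2_ip_self_bound:
  fixes u :: "'a \<Rightarrow> 'b::euclidean_space"
  assumes "u \<in> borel_measurable M" "(\<integral>\<^sup>+x. ennreal ((norm (u x))\<^sup>2) \<partial>M) \<le> ennreal e" "e \<ge> 0"
  shows "u \<in> square_integrable M \<and> L2_ip M u u \<le> e"
proof -
  have i: "integrable M (\<lambda>x. (norm (u x))\<^sup>2)"
    using assms by (intro integrableI_bounded) (auto simp: power2_eq_square intro: le_less_trans)
  then have "ennreal (LINT x|M. (norm (u x))\<^sup>2) \<le> ennreal e"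
    using assms(2) by (subst nn_integral_eq_integral[symmetric]) auto
  then show ?thesis using i assms by (auto simp: square_integrable_def L2_ip_self)
qed

lemma nn_integral_norm_sq:
  "u \<in> square_integrable M \<Longrightarrow> (\<integral>\<^sup>+x. ennreal ((norm (u x))\<^sup>2) \<partial>M) = ennreal (L2_ip M u u)"
  by (auto simp: L2_ip_self square_integrable_def intro!: nn_integral_eq_integral)

text \<open>The weights \<open>2 ^ n\<close> replace Minkowski's inequality: \<open>\<parallel>d\<parallel> \<le> 2 ^ n * \<parallel>d\<parallel>\<^sup>2 + (1/2) ^ n\<close>, and the
  sum of the integrals of \<open>2 ^ n * \<parallel>d n\<parallel>\<^sup>2\<close> is finite.\<close>

lemma AE_summable_of_fast_L2:
  fixes d :: "nat \<Rightarrow> 'a \<Rightarrow> 'b::euclidean_space"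
  assumes d: "\<And>n. d n \<in> square_integrable M" and small: "\<And>n. L2_ip M (d n) (d n) \<le> (1/4) ^ n"
  shows "AE x in M. summable (\<lambda>n. d n x)"
proof -
  have [measurable]: "d n \<in> borel_measurable M" for n using d by (rule square_integrable_measurable)
  have "(\<integral>\<^sup>+x. (\<Sum>n. ennreal (2 ^ n * (norm (d n x))\<^sup>2)) \<partial>M) = (\<Sum>n. \<integral>\<^sup>+x. ennreal (2 ^ n * (norm (d n x))\<^sup>2) \<partial>M)"
    by (rule nn_integral_suminf) measurable
  also have "\<dots> = (\<Sum>n. ennreal (2 ^ n * L2_ip M (d n) (d n)))"
    by (simp add: ennreal_mult nn_integral_cmult nn_integral_norm_sq d L2_space.ip_nonneg)
  also have "\<dots> \<le> (\<Sum>n. ennreal ((1/2) ^ n))"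
  proof (intro suminf_le ennreal_leI)
    show "2 ^ n * L2_ip M (d n) (d n) \<le> (1/2) ^ n" for n
    proof -
      have "2 ^ n * L2_ip M (d n) (d n) \<le> 2 ^ n * (1/4) ^ n" using small by simp
      also have "\<dots> = (1/2::real) ^ n" by (simp flip: power_mult_distrib)
      finally show ?thesis .
    qed
  qed auto
  also have "\<dots> = ennreal (\<Sum>n. (1/2) ^ n)"
    by (intro suminf_ennreal2 summable_geometric) auto
  finally have fin: "(\<integral>\<^sup>+x. (\<Sum>n. ennreal (2 ^ n * (norm (d n x))\<^sup>2)) \<partial>M) \<noteq> \<infinity>"
    by (auto simp: top_unique)
  have "AE x in M. (\<Sum>n. ennreal (2 ^ n * (norm (d n x))\<^sup>2)) \<noteq> \<infinity>"
    by (intro nn_integral_PInf_AE fin) measurable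
  then show ?thesis
  proof eventually_elim
    case (elim x)
    have s: "summable (\<lambda>n. 2 ^ n * (norm (d n x))\<^sup>2)"
      using elim by (intro summable_suminf_not_top) auto
    have "summable (\<lambda>n. norm (d n x))"
    proof (rule summable_comparison_test')
      show "summable (\<lambda>n. 2 ^ n * (norm (d n x))\<^sup>2 + (1/2) ^ n)"
        by (intro summable_add s summable_geometric) auto
      fix n :: nat
      have "0 \<le> (2 ^ n * norm (d n x) - 1)\<^sup>2 / 2 ^ n" by simp
      also have "\<dots> = 2 ^ n * (norm (d n x))\<^sup>2 + (1/2) ^ n - 2 * norm (d n x)"
        by (simp add: power2_eq_square field_simps)
      finally have "2 * norm (d n x) \<le> 2 ^ n * (norm (d n x))\<^sup>2 + (1/2) ^ n" by simp
      then show "norm (norm (d n x)) \<le> 2 ^ n * (norm (d n x))\<^sup>2 + (1/2) ^ n"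
        using norm_ge_zero[of "d n x"] unfolding real_norm_def abs_norm_cancel by linarith
    qed
    then show ?case by (rule summable_norm_cancel)
  qed
qed

text \<open>Riesz-Fischer: a rapidly Cauchy subsequence converges almost everywhere, and Fatou's
  lemma upgrades this to convergence in mean of the entire sequence.\<close>

lemma L2_complete:
  fixes X :: "nat \<Rightarrow> 'a \<Rightarrow> 'b::euclidean_space"
  assumes X: "\<And>n. X n \<in> square_integrable M"
    and cau: "\<And>e. e > 0 \<Longrightarrow> \<exists>N. \<forall>m\<ge>N. \<forall>n\<ge>N. L2_ip M (X m - X n) (X m - X n) < e"
  shows "\<exists>f\<in>square_integrable M. (\<lambda>n. L2_ip M (X n - f) (X n - f)) \<longlonglongrightarrow> 0"
proof -
  have "\<forall>k. \<exists>N. \<forall>m\<ge>N. \<forall>n\<ge>N. L2_ip M (X m - X n) (X m - X n) < (1/4) ^ k"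
    by (intro allI cau) simp
  then obtain N where N: "\<And>k m n. \<lbrakk>m \<ge> N k; n \<ge> N k\<rbrakk> \<Longrightarrow> L2_ip M (X m - X n) (X m - X n) < (1/4) ^ k"
    by metis
  \<comment> \<open>The sum puts \<open>r k\<close> and \<open>r (Suc k)\<close> beyond
    \<open>N k\<close>, which makes the increments small; the extra \<open>k\<close> makes
    \<open>r\<close> unbounded, as the limit along the subsequence requires.\<close>
  define r where "r k = k + (\<Sum>j\<le>k. N j)" for k
  have rN: "r k \<ge> N k" "r (Suc k) \<ge> N k" for k
  proof -
    show "r k \<ge> N k" unfolding r_def by (simp add: member_le_sum trans_le_add2)
    have "N k \<le> (\<Sum>j\<le>Suc k. N j)" by (rule member_le_sum) auto
    then show "r (Suc k) \<ge> N k" unfolding r_def by linarith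
  qed
  have r_ge: "r k \<ge> k" for k by (simp add: r_def)
  have [measurable]: "X n \<in> borel_measurable M" for n using X by (rule square_integrable_measurable)
  define d where "d k = X (r (Suc k)) - X (r k)" for k
  have d: "d k \<in> square_integrable M" for k unfolding d_def using X by blast
  have summ: "AE x in M. summable (\<lambda>n. d n x)"
    using N[OF rN(2) rN(1)] unfolding d_def[symmetric] by (intro AE_summable_of_fast_L2 d less_imp_le)
  \<comment> \<open>The value where the series diverges is irrelevant, as this happens on a null
    set.\<close>
  define f where "f x = X (r 0) x + (\<Sum>n. d n x)" for x
  have conv: "AE x in M. (\<lambda>n. X (r n) x) \<longlonglongrightarrow> f x"
    using summ
  proof eventually_elim
    case (elim x)
    have "(\<Sum>j<n. d j x) = X (r n) x - X (r 0) x" for n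
      by (induction n) (auto simp: d_def)
    then have "(\<lambda>n. X (r 0) x + (\<Sum>j<n. d j x)) = (\<lambda>n. X (r n) x)" by auto
    then show ?case
      using tendsto_add[OF tendsto_const[of "X (r 0) x"] summable_LIMSEQ[OF elim]] by (simp add: f_def)
  qed
  have f_meas [measurable]: "f \<in> borel_measurable M"
  proof -
    have [measurable]: "d n \<in> borel_measurable M" for n using d by (rule square_integrable_measurable)
    show ?thesis unfolding f_def by measurable
  qed
  \<comment> \<open>Fatou's lemma along \<open>X (r n)\<close> carries the Cauchy bound over to the
    limit. Membership comes out together with the bound, since \<open>f\<close> is not yet known to
    be square integrable.\<close>
  have key: "X m - f \<in> square_integrable M \<and> L2_ip M (X m - f) (X m - f) \<le> (1/4) ^ k"
    if "m \<ge> N k" for m k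
  proof (rule L2_ip_self_bound)
    show "X m - f \<in> borel_measurable M" by (simp add: fun_diff_def)
    have "(\<integral>\<^sup>+x. ennreal ((norm ((X m - f) x))\<^sup>2) \<partial>M)
        = (\<integral>\<^sup>+x. liminf (\<lambda>n. ennreal ((norm ((X m - X (r n)) x))\<^sup>2)) \<partial>M)"
    proof (rule nn_integral_cong_AE)
      show "AE x in M. ennreal ((norm ((X m - f) x))\<^sup>2) = liminf (\<lambda>n. ennreal ((norm ((X m - X (r n)) x))\<^sup>2))"
        using conv
      proof eventually_elim
        case (elim x)
        have "(\<lambda>n. ennreal ((norm ((X m - X (r n)) x))\<^sup>2)) \<longlonglongrightarrow> ennreal ((norm ((X m - f) x))\<^sup>2)"
          using elim by (auto intro!: tendsto_intros)
        then show ?case by (rule lim_imp_Liminf[OF sequentially_bot, symmetric])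
      qed
    qed
    also have "\<dots> \<le> liminf (\<lambda>n. \<integral>\<^sup>+x. ennreal ((norm ((X m - X (r n)) x))\<^sup>2) \<partial>M)"
      by (rule nn_integral_liminf) (simp add: fun_diff_def)
    also have "\<dots> \<le> liminf (\<lambda>n. ennreal ((1/4) ^ k))"
    proof (rule Liminf_mono)
      have "(\<integral>\<^sup>+x. ennreal ((norm ((X m - X (r n)) x))\<^sup>2) \<partial>M) \<le> ennreal ((1/4) ^ k)" if "n \<ge> N k" for n
      proof -
        have "r n \<ge> N k" using that r_ge[of n] by linarith
        then show ?thesis
          using N[OF \<open>m \<ge> N k\<close>, of "r n"] X by (subst nn_integral_norm_sq) (auto intro: ennreal_leI less_imp_le)
      qed
      then show "\<forall>\<^sub>F n in sequentially. (\<integral>\<^sup>+x. ennreal ((norm ((X m - X (r n)) x))\<^sup>2) \<partial>M) \<le> ennreal ((1/4) ^ k)"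
        by (auto simp: eventually_sequentially)
    qed
    also have "\<dots> = ennreal ((1/4) ^ k)" by (simp add: Liminf_const)
    finally show "(\<integral>\<^sup>+x. ennreal ((norm ((X m - f) x))\<^sup>2) \<partial>M) \<le> ennreal ((1/4) ^ k)" .
  qed simp
  have "f = X (N 0) - (X (N 0) - f)" by simp
  also have "\<dots> \<in> square_integrable M" using key[of 0 "N 0"] X by blast
  finally have f: "f \<in> square_integrable M" .
  have "(\<lambda>n. L2_ip M (X n - f) (X n - f)) \<longlonglongrightarrow> 0"
  proof (rule LIMSEQ_I)
    fix e :: real assume "e > 0"
    then obtain k where k: "(1/4::real) ^ k < e" using real_arch_pow_inv[of e "1/4"] by auto
    have "norm (L2_ip M (X n - f) (X n - f) - 0) < e" if "n \<ge> N k" for n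
      using key[OF that] k L2_space.ip_nonneg[of "X n - f" M] by auto
    then show "\<exists>no. \<forall>n\<ge>no. norm (L2_ip M (X n - f) (X n - f) - 0) < e" by blast
  qed
  then show ?thesis using f by blast
qed

lemma semi_hilbert_space_L2: "semi_hilbert_space (square_integrable M) (L2_ip M)"
  by unfold_locales (rule L2_complete)

lemma L2_ip_self_eq_0_imp_AE:
  assumes "u \<in> square_integrable M" "L2_ip M u u = 0"
  shows "AE x in M. u x = 0"
proof -
  have "AE x in M. (norm (u x))\<^sup>2 = 0"
    using assms by (subst integral_nonneg_eq_0_iff_AE[symmetric]) (auto simp: L2_ip_self square_integrable_def)
  then show ?thesis by simp
qed

section \<open>The fundamental lemma of the calculus of variations\<close>

lemma grad_nth_eq:
  assumes "(f has_derivative f') (at x)"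
  shows "grad f x $ i = f' (axis i 1)"
  using frechet_derivative_at[OF assms] by (simp add: grad_def)

lemma grad_const [simp]: "grad (\<lambda>_. c) x = 0"
  by (auto simp: vec_eq_iff grad_nth_eq[OF has_derivative_const])

lemma C_k_const: "C_k k (\<lambda>_. c)"
  by (induction k arbitrary: c) auto

lemma C_k_Suc_imp: "C_k (Suc k) f \<Longrightarrow> C_k k f"
  by (induction k arbitrary: f) (auto intro: differentiable_imp_continuous_on)

lemma differentiable_has_derivative:
  "f differentiable_on UNIV \<Longrightarrow> (f has_derivative frechet_derivative f (at x)) (at x)"
  by (simp add: differentiable_on_def frechet_derivative_works)

lemma C_k_add:
  assumes "C_k k f" "C_k k g" shows "C_k k (\<lambda>x. f x + g x)"
  using assms
proof (induction k arbitrary: f g)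
  case 0
  then show ?case by (auto intro: continuous_on_add)
next
  case (Suc k)
  then have d: "f differentiable_on UNIV" "g differentiable_on UNIV" by auto
  have "grad (\<lambda>x. f x + g x) x $ i = grad f x $ i + grad g x $ i" for x i
    by (subst grad_nth_eq[OF has_derivative_add[OF d[THEN differentiable_has_derivative]]]) (simp add: grad_def)
  then show ?case using Suc d by (auto intro: differentiable_on_add)
qed

lemma C_k_mult:
  assumes "C_k k f" "C_k k g" shows "C_k k (\<lambda>x. f x * g x)"
  using assms
proof (induction k arbitrary: f g)
  case 0
  then show ?case by (auto intro: continuous_on_mult)
next
  case (Suc k)
  then have d: "f differentiable_on UNIV" "g differentiable_on UNIV" by auto
  have "grad (\<lambda>x. f x * g x) x $ i = f x * grad g x $ i + grad f x $ i * g x" for x i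
    by (subst grad_nth_eq[OF has_derivative_mult[OF d[THEN differentiable_has_derivative]]]) (simp add: grad_def)
  \<comment> \<open>The product rule leaves one factor undifferentiated, so \<open>f\<close> and
    \<open>g\<close> themselves are needed at the lower order.\<close>
  then show ?case using Suc.IH Suc.prems d C_k_Suc_imp[OF Suc.prems(1)] C_k_Suc_imp[OF Suc.prems(2)]
    by (auto intro!: differentiable_on_mult C_k_add)
qed

lemma C_k_prod:
  assumes "finite I" "\<And>i. i \<in> I \<Longrightarrow> C_k k (f i)"
  shows "C_k k (\<lambda>x. \<Prod>i\<in>I. f i x)"
  using assms by (induction I) (auto intro: C_k_const C_k_mult)

text \<open>The derivatives of \<open>exp (- 1 / t)\<close>, extended by \<open>0\<close>, are linear combinations of these.\<close>

definition flat_exp :: "nat \<Rightarrow> real \<Rightarrow> real" where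
  "flat_exp n t = (if t > 0 then inverse t ^ n * exp (- inverse t) else 0)"

text \<open>In the variable \<open>inverse t\<close> this is the decay of powers against the
  exponential.\<close>

lemma tendsto_flat_exp_at_right_0: "(flat_exp n \<longlongrightarrow> 0) (at_right 0)"
proof -
  have "((\<lambda>t. inverse t ^ n / exp (inverse t)) \<longlongrightarrow> 0) (at_right (0::real))"
    by (rule filterlim_compose[OF tendsto_power_div_exp_0 filterlim_inverse_at_top_right])
  moreover have "\<forall>\<^sub>F t in at_right 0. inverse t ^ n / exp (inverse t) = flat_exp n t"
    by (auto simp: eventually_at_right_field flat_exp_def exp_minus field_simps intro!: exI[of _ 1])
  ultimately show ?thesis by (rule Lim_transform_eventually)
qed

text \<open>Differentiation stays within the span of the family and only raises the index, which
  gives every order of smoothness by induction.\<close>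

lemma has_real_derivative_flat_exp:
  "(flat_exp n has_real_derivative flat_exp (n + 2) t - real n * flat_exp (n + 1) t) (at t)"
proof -
  consider "t > 0" | "t < 0" | "t = 0" by linarith
  then show ?thesis
  proof cases
    case 1
    have "((\<lambda>t. inverse t ^ n * exp (- inverse t)) has_real_derivative
        flat_exp (n + 2) t - real n * flat_exp (n + 1) t) (at t)"
    proof (cases n)
      case 0
      then show ?thesis
        using 1 by (auto simp: flat_exp_def field_simps power2_eq_square intro!: derivative_eq_intros)
    next
      case (Suc k)
      have p: "((\<lambda>t. inverse t ^ Suc k) has_real_derivative
          (1 + real k) * (inverse t ^ k * (- (inverse t ^ 2)))) (at t)"
        using DERIV_power_Suc[OF DERIV_inverse, of t k] 1 by (simp add: power2_eq_square ac_simps)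
      have e: "((\<lambda>t. exp (- inverse t)) has_real_derivative exp (- inverse t) * inverse t ^ 2) (at t)"
        using 1 by (auto intro!: derivative_eq_intros simp: power2_eq_square)
      from DERIV_mult[OF p e] show ?thesis
        using 1 by (simp add: Suc flat_exp_def algebra_simps power2_eq_square)
    qed
    then show ?thesis
      by (rule has_field_derivative_transform_within_open[where S = "{0<..}"]) (use 1 in \<open>auto simp: flat_exp_def\<close>)
  next
    case 2
    have "((\<lambda>_. 0) has_real_derivative flat_exp (n + 2) t - real n * flat_exp (n + 1) t) (at t)"
      using 2 by (simp add: flat_exp_def)
    then show ?thesis
      by (rule has_field_derivative_transform_within_open[where S = "{..<0}"]) (use 2 in \<open>auto simp: flat_exp_def\<close>)
  next
    case 3
    \<comment> \<open>At the origin the difference quotient is 0 on the left and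
      \<open>flat_exp (Suc n)\<close> on the right.\<close>
    have "((\<lambda>h. flat_exp n h / h) \<longlongrightarrow> 0) (at 0)"
    proof (rule filterlim_split_at)
      have "\<forall>\<^sub>F h in at_left (0::real). 0 = flat_exp n h / h"
        by (auto simp: eventually_at_left_field flat_exp_def intro!: exI[of _ "-1"])
      then show "((\<lambda>h. flat_exp n h / h) \<longlongrightarrow> 0) (at_left 0)"
        by (rule Lim_transform_eventually[OF tendsto_const])
      have "\<forall>\<^sub>F h in at_right 0. flat_exp (Suc n) h = flat_exp n h / h"
        by (auto simp: eventually_at_right_field flat_exp_def field_simps intro!: exI[of _ 1])
      then show "((\<lambda>h. flat_exp n h / h) \<longlongrightarrow> 0) (at_right 0)"
        by (rule Lim_transform_eventually[OF tendsto_flat_exp_at_right_0])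
    qed
    then show ?thesis using 3 by (simp add: has_field_derivative_iff flat_exp_def)
  qed
qed

lemma flat_exp_bounds: "0 \<le> flat_exp 0 t" "flat_exp 0 t \<le> 1"
  by (auto simp: flat_exp_def)

lemma flat_exp_eq_0_iff: "flat_exp 0 t = 0 \<longleftrightarrow> t \<le> 0"
  by (auto simp: flat_exp_def)

text \<open>The index is generalised because each derivative raises it. The slope \<open>s\<close>
  serves both orientations of the faces of a box and any steepness.\<close>

lemma C_k_flat_exp: "C_k k (\<lambda>x::real^'n. flat_exp n (s * x $ i + t))"
proof (induction k arbitrary: n)
  case 0
  have "continuous_on UNIV (flat_exp n)"
    using has_real_derivative_flat_exp by (intro DERIV_continuous_on) (auto intro: has_field_derivative_at_within)
  then have "continuous_on UNIV (\<lambda>x::real^'n. flat_exp n (s * x $ i + t))"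
    by (rule continuous_on_compose2) (auto intro!: continuous_intros)
  then show ?case by simp
next
  case (Suc k)
  define D where "D x = flat_exp (n + 2) (s * x $ i + t) + (- real n) * flat_exp (n + 1) (s * x $ i + t)" for x :: "real^'n"
  have der: "((\<lambda>x. flat_exp n (s * x $ i + t)) has_derivative (\<lambda>h. (s * h $ i) * D x)) (at x)" for x
  proof -
    have "((\<lambda>x::real^'n. s * x $ i + t) has_derivative (\<lambda>h. s * h $ i)) (at x)"
      by (auto intro!: derivative_eq_intros bounded_linear.has_derivative[OF bounded_linear_vec_nth])
    from DERIV_compose_FDERIV[OF has_real_derivative_flat_exp this]
    show ?thesis by (simp add: D_def)
  qed
  have "C_k k D" unfolding D_def by (intro C_k_add C_k_mult C_k_const Suc.IH)
  then have "C_k k (\<lambda>x. (s * axis j 1 $ i) * D x)" for j by (intro C_k_mult C_k_const)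
  moreover have "grad (\<lambda>x. flat_exp n (s * x $ i + t)) x $ j = (s * axis j 1 $ i) * D x" for x j
    by (rule grad_nth_eq[OF der])
  moreover have "(\<lambda>x::real^'n. flat_exp n (s * x $ i + t)) differentiable_on UNIV"
    using der by (auto simp: differentiable_on_def differentiable_def)
  ultimately show ?case by simp
qed

text \<open>One factor for each face of the box, with steepness \<open>m\<close>. For growing
  \<open>m\<close> the bumps tend to the indicator of the open box, so integrals over boxes are
  limits of test integrals; this takes the place of mollification.\<close>

definition box_bump :: "nat \<Rightarrow> real^'n \<Rightarrow> real^'n \<Rightarrow> real^'n \<Rightarrow> real" where
  "box_bump m a b x = (\<Prod>i\<in>UNIV. flat_exp 0 (real m * (x $ i - a $ i)) * flat_exp 0 (real m * (b $ i - x $ i)))"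

lemma smooth_box_bump: "smooth (box_bump m a b)"
proof -
  have "C_k k (\<lambda>x. \<Prod>i\<in>UNIV. flat_exp 0 (real m * x $ i + (- real m * a $ i))
      * flat_exp 0 ((- real m) * x $ i + real m * b $ i))" for k
    by (intro C_k_prod C_k_mult C_k_flat_exp) auto
  then show ?thesis by (simp add: smooth_def box_bump_def[abs_def] algebra_simps)
qed

lemma box_bump_outside: "x \<notin> box a b \<Longrightarrow> box_bump m a b x = 0"
  by (force simp: box_bump_def mem_box_cart flat_exp_eq_0_iff mult_le_0_iff not_less)

lemma box_bump_bounds: "0 \<le> box_bump m a b x" "box_bump m a b x \<le> 1"
  unfolding box_bump_def by (auto intro!: prod_nonneg prod_le_1 mult_le_one simp: flat_exp_bounds)

lemma box_bump_test_function:
  assumes "cbox a b \<subseteq> \<Omega>" shows "box_bump m a b \<in> test_functions \<Omega>"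
proof -
  have "supp (box_bump m a b) \<subseteq> cbox a b"
    unfolding supp_def using box_bump_outside[of _ a b m] box_subset_cbox[of a b] by (intro closure_minimal closed_cbox) auto
  then show ?thesis
    using assms smooth_box_bump compact_Int_closed[OF compact_cbox, of "supp (box_bump m a b)" a b]
    by (auto simp: test_functions_def supp_def Int_absorb1)
qed

lemma tendsto_box_bump: "(\<lambda>m. box_bump m a b x) \<longlonglongrightarrow> indicator (box a b) x"
proof (cases "x \<in> box a b")
  case True
  have "(\<lambda>m. flat_exp 0 (real m * y)) \<longlonglongrightarrow> 1" if "y > 0" for y
  proof -
    have "(\<lambda>m. inverse (real m) * inverse y) \<longlonglongrightarrow> 0 * inverse y"
      by (intro tendsto_mult lim_inverse_n tendsto_const)
    then have "(\<lambda>m. exp (- (inverse (real m) * inverse y))) \<longlonglongrightarrow> exp (- (0 * inverse y))"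
      by (intro tendsto_exp tendsto_minus)
    then have 1: "(\<lambda>m. exp (- (inverse (real m) * inverse y))) \<longlonglongrightarrow> 1" by simp
    \<comment> \<open>The equality holds for \<open>m > 0\<close> only: at \<open>m = 0\<close> the
      right side is 0 and the left side is 1.\<close>
    have 2: "\<forall>\<^sub>F m in sequentially. exp (- (inverse (real m) * inverse y)) = flat_exp 0 (real m * y)"
      using eventually_gt_at_top[of "0::nat"] by eventually_elim (use that in \<open>simp add: flat_exp_def\<close>)
    show ?thesis by (rule Lim_transform_eventually[OF 1 2])
  qed
  then have "(\<lambda>m. box_bump m a b x) \<longlonglongrightarrow> (\<Prod>i\<in>(UNIV::'a set). 1 * 1)"
    unfolding box_bump_def using True by (intro tendsto_prod tendsto_mult) (auto simp: mem_box_cart)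
  then show ?thesis using True by simp
next
  case False
  then show ?thesis by (simp add: box_bump_outside)
qed

section \<open>From vanishing test integrals to vanishing almost everywhere\<close>

lemma AE_eq_0_if_box_integrals_eq_0:
  fixes h :: "real^'n \<Rightarrow> real"
  assumes h: "integrable lborel h" and box: "\<And>a b. set_lebesgue_integral lborel (box a b) h = 0"
    and UN: "integral\<^sup>L lborel h = 0"
  shows "AE x in lborel. h x = 0"
proof (rule sigma_finite_measure.density_zero[OF sigma_finite_lborel h])
  have si: "set_integrable lborel A h" if "A \<in> sets borel" for A
    using h that unfolding set_integrable_def by (intro integrable_mult_indicator) auto
  fix A assume "A \<in> sets (lborel :: (real^'n) measure)"
  then have A: "A \<in> sigma_sets UNIV (range (\<lambda>(a, b). box a b :: (real^'n) set))"
    by (simp add: borel_eq_box)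
  \<comment> \<open>Open boxes are an intersection-stable generator of the Borel sets, so the
    vanishing spreads by a Dynkin argument.\<close>
  have "Int_stable (range (\<lambda>(a, b). box a b :: (real^'n) set))"
    by (auto simp: Int_stable_def box_Int_box)
  from this _ A show "set_lebesgue_integral lborel A h = 0"
  proof (rule sigma_sets_induct_disjoint)
    fix A assume A: "A \<in> sigma_sets UNIV (range (\<lambda>(a, b). box a b :: (real^'n) set))"
      and 0: "set_lebesgue_integral lborel A h = 0"
    then have Ab: "A \<in> sets borel" by (simp add: borel_eq_box)
    \<comment> \<open>Complements bring in the integral over the whole space, which is not a box;
      this is the assumption \<open>UN\<close>.\<close>
    have "set_lebesgue_integral lborel (A \<union> (UNIV - A)) h
        = set_lebesgue_integral lborel A h + set_lebesgue_integral lborel (UNIV - A) h"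
      by (intro set_integral_Un si) (use Ab in auto)
    then show "set_lebesgue_integral lborel (UNIV - A) h = 0"
      using 0 UN by (simp add: set_lebesgue_integral_def)
  next
    fix A :: "nat \<Rightarrow> (real^'n) set"
    assume d: "disjoint_family A" and A: "range A \<subseteq> sigma_sets UNIV (range (\<lambda>(a, b). box a b))"
      and 0: "\<And>i. set_lebesgue_integral lborel (A i) h = 0"
    then have Ab: "A i \<in> sets borel" for i by (auto simp: borel_eq_box)
    have "set_lebesgue_integral lborel (\<Union>i. A i) h = (\<Sum>i. set_lebesgue_integral lborel (A i) h)"
      by (intro lebesgue_integral_countable_add si) (use Ab d in \<open>auto simp: disjoint_family_on_def\<close>)
    then show "set_lebesgue_integral lborel (\<Union> (range A)) h = 0" using 0 by simp
  qed (use box in \<open>auto simp: set_lebesgue_integral_def\<close>)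
qed

text \<open>Bumps are test functions only for boxes whose closure lies in \<open>\<Omega>\<close>.
  So the function is cut off to one such box at a time, shown to vanish there, and the boxes are
  patched along a countable cover.\<close>

theorem fundamental_lemma_calculus_of_variations:
  fixes g :: "real^'n \<Rightarrow> real"
  assumes \<Omega>: "open \<Omega>" and g: "integrable (lebesgue_on \<Omega>) g"
    and test: "\<And>\<phi>. \<phi> \<in> test_functions \<Omega> \<Longrightarrow> (LINT x|lebesgue_on \<Omega>. g x * \<phi> x) = 0"
  shows "AE x in lebesgue_on \<Omega>. g x = 0"
proof -
  have [measurable]: "\<Omega> \<in> sets lebesgue" using \<Omega> by (simp add: borel_open)
  define G where "G x = indicator \<Omega> x * g x" for x
  have G: "integrable lebesgue G"
    using g by (simp add: G_def[abs_def] integrable_restrict_space)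
  then have [measurable]: "G \<in> borel_measurable lebesgue" by auto
  have box0: "(LINT x|lebesgue. indicator (box a b) x * G x) = 0" if "cbox a b \<subseteq> \<Omega>" for a b
  proof (rule LIMSEQ_unique)
    show "(\<lambda>m. LINT x|lebesgue. box_bump m a b x * G x) \<longlonglongrightarrow> (LINT x|lebesgue. indicator (box a b) x * G x)"
    proof (rule integral_dominated_convergence)
      show "integrable lebesgue (\<lambda>x. \<bar>G x\<bar>)" using G by simp
      have "continuous_on UNIV (box_bump m a b)" for m
        using smooth_box_bump[of m a b] unfolding smooth_def by (metis C_k.simps(1))
      then have "box_bump m a b \<in> borel_measurable lebesgue" for m
        by (simp add: borel_measurable_continuous_onI measurable_completion)
      from borel_measurable_times[OF this borel_measurable_integrable[OF G]] show "(\<lambda>x. box_bump m a b x * G x) \<in> borel_measurable lebesgue" for m .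
      show "AE x in lebesgue. (\<lambda>m. box_bump m a b x * G x) \<longlonglongrightarrow> indicator (box a b) x * G x"
        by (intro AE_I2 tendsto_mult tendsto_box_bump tendsto_const)
      show "AE x in lebesgue. norm (box_bump m a b x * G x) \<le> \<bar>G x\<bar>" for m
        using box_bump_bounds[of m a b] by (intro AE_I2) (simp add: abs_mult mult_left_le_one_le)
      show "(\<lambda>x. indicator (box a b) x * G x) \<in> borel_measurable lebesgue"
        using borel_measurable_integrable[OF integrable_mult_indicator[OF _ G, of "box a b"]] by simp
    qed
    have "(LINT x|lebesgue. box_bump m a b x * G x) = 0" for m
      using test[OF box_bump_test_function[OF that, of m]]
      by (simp add: integral_restrict_space G_def ac_simps)
    then show "(\<lambda>m. LINT x|lebesgue. box_bump m a b x * G x) \<longlonglongrightarrow> 0" by simp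
  qed
  have local: "AE x in lebesgue. x \<in> cbox c d \<longrightarrow> G x = 0" if cd: "cbox c d \<subseteq> \<Omega>" for c d
  proof -
    define h where "h x = indicator (box c d) x * G x" for x
    have h: "integrable lebesgue h" unfolding h_def using integrable_mult_indicator[OF _ G, of "box c d"] by simp
    \<comment> \<open>The Dynkin argument lives on Borel sets, so \<open>h\<close> is exchanged for
      a Borel version and integrals are moved between \<open>lborel\<close> and its
      completion.\<close>
    then obtain h' where h': "h' \<in> borel_measurable lborel" and eq: "AE x in lborel. h x = h' x"
      using completion_ex_borel_measurable_real[of h lborel] by auto
    have eq': "AE x in lebesgue. h x = h' x" using eq by (rule AE_completion)
    have h'm: "h' \<in> borel_measurable lebesgue" using h' by (rule measurable_completion)
    have "integrable lebesgue h'"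
      using integrable_cong_AE[OF borel_measurable_integrable[OF h] h'm eq'] h by simp
    then have h'i: "integrable lborel h'" using h' integrable_completion by blast
    have int_box: "integral\<^sup>L lborel (\<lambda>x. indicator (box a b) x * h' x) = 0" for a b
    proof -
      have "integral\<^sup>L lborel (\<lambda>x. indicator (box a b) x * h' x) = integral\<^sup>L lebesgue (\<lambda>x. indicator (box a b) x * h' x)"
        using h' by (intro integral_completion[symmetric]) auto
      also have "\<dots> = integral\<^sup>L lebesgue (\<lambda>x. indicator (box a b) x * h x)"
        using eq' by (intro integral_cong_AE borel_measurable_times borel_measurable_indicator) (use h h'm in auto)
      also have "\<dots> = integral\<^sup>L lebesgue (\<lambda>x. indicator (box a b \<inter> box c d) x * G x)"
        by (simp add: h_def indicator_inter_arith mult.assoc)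
      also have "\<dots> = 0"
      proof -
        obtain a' b' where ab: "box a b \<inter> box c d = box a' b'" by (simp add: box_Int_box)
        show ?thesis
        \<comment> \<open>Only for a nonempty open box is \<open>cbox a' b'\<close> its closure; a
          degenerate closed box need not lie in \<open>cbox c d\<close>.\<close>
        proof (cases "box a' b' = {}")
          case False
          then have "cbox a' b' = closure (box a' b')" by (simp add: closure_box)
          also have "\<dots> \<subseteq> cbox c d"
            using ab box_subset_cbox[of c d] by (intro closure_minimal closed_cbox) auto
          finally show ?thesis unfolding ab using cd by (intro box0) auto
        qed (simp add: ab)
      qed
      finally show ?thesis .
    qed
    have "integral\<^sup>L lborel h' = integral\<^sup>L lebesgue h'" using h' by (rule integral_completion[symmetric])
    also have "\<dots> = integral\<^sup>L lebesgue h" using eq' h h'm by (intro integral_cong_AE) auto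
    also have "\<dots> = 0" unfolding h_def using cd by (rule box0)
    finally have "AE x in lborel. h' x = 0"
      using int_box by (intro AE_eq_0_if_box_integrals_eq_0 h'i) (simp_all add: set_lebesgue_integral_def)
    then have "AE x in lebesgue. h' x = 0" by (rule AE_completion)
    \<comment> \<open>The cut-off is to the open box, while the cover below consists of closed ones;
      the faces between them are null.\<close>
    moreover have "AE x in lebesgue. x \<notin> cbox c d - box c d"
      by (rule AE_not_in) (simp add: negligible_iff_null_sets[symmetric] negligible_frontier_interval)
    ultimately show ?thesis using eq' by eventually_elim (auto simp: h_def indicator_def)
  qed
  obtain D where D: "countable D" "D \<subseteq> Pow \<Omega>" "\<And>X. X \<in> D \<Longrightarrow> \<exists>a b. X = cbox a b" "\<Union>D = \<Omega>"
    by (rule open_countable_Union_open_cbox[OF \<Omega>]) auto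
  have "\<forall>X\<in>D. AE x in lebesgue. x \<in> X \<longrightarrow> G x = 0"
    using D(2,3) local by blast
  then have "AE x in lebesgue. \<forall>X\<in>D. x \<in> X \<longrightarrow> G x = 0" 
    using D(1) by (subst AE_ball_countable)
  then have "AE x in lebesgue. x \<in> \<Omega> \<longrightarrow> g x = 0"
    by eventually_elim (use D(4) in \<open>auto simp: G_def indicator_def\<close>)
  then show ?thesis by (simp add: AE_restrict_space_iff)
qed

section \<open>The spaces of fields with square integrable divergence\<close>

lemma smooth_continuous_on: "smooth w \<Longrightarrow> continuous_on S w"
  unfolding smooth_def by (metis C_k.simps(1) continuous_on_subset subset_UNIV)

lemma smooth_continuous_on_grad:
  fixes w :: "real^'n \<Rightarrow> real"
  assumes "smooth w" shows "continuous_on S (grad w)"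
proof -
  have "C_k (Suc 0) w" using assms by (simp add: smooth_def)
  then have "continuous_on UNIV (\<lambda>x. grad w x $ i)" for i by simp
  then have "continuous_on UNIV (\<lambda>x. \<chi> i. grad w x $ i)" by (rule continuous_on_vec_lambda)
  then show ?thesis using continuous_on_subset[of UNIV "grad w" S] by simp
qed

lemma L2_ip_cong_AE:
  assumes "u \<in> square_integrable M" "v \<in> square_integrable M" "AE x in M. u x = v x"
  shows "w \<in> square_integrable M \<Longrightarrow> L2_ip M u w = L2_ip M v w"
    and "w \<in> square_integrable M \<Longrightarrow> L2_ip M w u = L2_ip M w v"
proof -
  have [measurable]: "u \<in> borel_measurable M" "v \<in> borel_measurable M"
    using assms by (auto intro: square_integrable_measurable)
  show *: "L2_ip M u w = L2_ip M v w" if w: "w \<in> square_integrable M" for w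
  proof -
    have [measurable]: "w \<in> borel_measurable M" using w by (rule square_integrable_measurable)
    show ?thesis unfolding L2_ip_def using assms(3) by (intro integral_cong_AE) auto
  qed
  show "w \<in> square_integrable M \<Longrightarrow> L2_ip M w u = L2_ip M w v"
    using *[of w] assms by (metis L2_space.ip_commute)
qed

section \<open>Weak divergence on a bounded open set\<close>

locale bounded_open_set =
  fixes \<Omega> :: "(real^'n) set"
  assumes open_Omega: "open \<Omega>" and bounded_Omega: "bounded \<Omega>"
begin

abbreviation "M \<equiv> lebesgue_on \<Omega>"

lemma Omega_sets [measurable]: "\<Omega> \<in> sets lebesgue"
  using open_Omega by (simp add: borel_open)

sublocale finite_measure M
  using bounded_Omega by (intro finite_measure_lebesgue_on lmeasurable_open open_Omega)

text \<open>The functions \<open>w\<close> testing a normal trace need neither compact support nor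
  zero boundary values. They are square integrable because the closure of the bounded set
  \<open>\<Omega>\<close> is compact.\<close>

lemma continuous_square_integrable:
  fixes f :: "real^'n \<Rightarrow> 'b::euclidean_space"
  assumes "continuous_on UNIV f" shows "f \<in> square_integrable M"
proof -
  have "compact (f ` closure \<Omega>)"
    using bounded_Omega by (intro compact_continuous_image) (auto intro: continuous_on_subset[OF assms] simp: compact_closure)
  then obtain B where "\<And>y. y \<in> f ` closure \<Omega> \<Longrightarrow> norm y \<le> B"
    using compact_imp_bounded[of "f ` closure \<Omega>"] unfolding bounded_iff by meson
  then have B: "norm (f x) \<le> B" if "x \<in> \<Omega>" for x
    using that closure_subset[of \<Omega>] by blast
  have f: "f \<in> borel_measurable M"
    using assms by (intro continuous_imp_measurable_on_sets_lebesgue) (auto intro: continuous_on_subset)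
  have "integrable M (\<lambda>x. (norm (f x))\<^sup>2)"
  proof (rule integrable_const_bound)
    show "AE x in M. norm ((norm (f x))\<^sup>2) \<le> B\<^sup>2"
      using B by (intro AE_I2) (auto intro!: power_mono)
  qed (use f in measurable)
  then show ?thesis using f by (simp add: square_integrable_def)
qed

lemma smooth_square_integrable:
  assumes "smooth w" shows "w \<in> square_integrable M" "grad w \<in> square_integrable M"
  using assms by (auto intro: continuous_square_integrable smooth_continuous_on smooth_continuous_on_grad)

lemma test_function_smooth: "\<phi> \<in> test_functions \<Omega> \<Longrightarrow> smooth \<phi>"
  by (simp add: test_functions_def)

lemma has_weak_div_iff:
  "has_weak_div \<Omega> v g \<longleftrightarrow> v \<in> square_integrable M \<and> g \<in> square_integrable M \<and>
     (\<forall>\<phi>\<in>test_functions \<Omega>. L2_ip M v (grad \<phi>) = - L2_ip M g \<phi>)"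
  by (simp add: has_weak_div_def L2_eq L2_ip_def)

lemma L2_ip_test_functions_eq_0:
  fixes g :: "real^'n \<Rightarrow> real"
  assumes g: "g \<in> square_integrable M" and "\<And>\<phi>. \<phi> \<in> test_functions \<Omega> \<Longrightarrow> L2_ip M g \<phi> = 0"
  shows "AE x in M. g x = 0"
proof (rule fundamental_lemma_calculus_of_variations[OF open_Omega])
  have "(\<lambda>_. 1::real) \<in> square_integrable M" by (intro continuous_square_integrable) auto
  from integrable_inner[OF g this] show "integrable M g" by simp
qed (use assms(2) in \<open>simp add: L2_ip_def\<close>)

text \<open>Both divergences have the same integrals against test functions, so the fundamental
  lemma applies to their difference. This makes the choice in \<open>weak_div\<close>
  harmless.\<close>

lemma has_weak_div_unique:
  assumes "has_weak_div \<Omega> v g" "has_weak_div \<Omega> v g'"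
  shows "AE x in M. g x = g' x"
proof -
  have g: "g \<in> square_integrable M" "g' \<in> square_integrable M" using assms by (auto simp: has_weak_div_iff)
  have "AE x in M. (g - g') x = 0"
  proof (rule L2_ip_test_functions_eq_0)
    show "g - g' \<in> square_integrable M" using g by blast
    show "L2_ip M (g - g') \<phi> = 0" if "\<phi> \<in> test_functions \<Omega>" for \<phi>
      using assms that g smooth_square_integrable(1)[OF test_function_smooth[OF that]]
      by (auto simp: L2_space.ip_diff_left has_weak_div_iff)
  qed
  then show ?thesis by simp
qed

lemma weak_div: "v \<in> Hdiv \<Omega> \<Longrightarrow> has_weak_div \<Omega> v (weak_div \<Omega> v)"
  unfolding weak_div_def Hdiv_def using someI_ex[of "has_weak_div \<Omega> v"] by simp

lemma Hdiv_square_integrable: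
  assumes "v \<in> Hdiv \<Omega>" shows "v \<in> square_integrable M" "weak_div \<Omega> v \<in> square_integrable M"
  using weak_div[OF assms] by (auto simp: has_weak_div_iff)

lemma weak_div_AE_eq: "has_weak_div \<Omega> v g \<Longrightarrow> AE x in M. weak_div \<Omega> v x = g x"
  by (rule has_weak_div_unique[OF weak_div]) (auto simp: Hdiv_def)

text \<open>Within an inner product the chosen divergence may be replaced by any other. Linearity of
  \<open>weak_div\<close>, which may fail pointwise, is recovered in this form.\<close>

lemma L2_ip_weak_div_eq:
  assumes "has_weak_div \<Omega> v g" "w \<in> square_integrable M"
  shows "L2_ip M (weak_div \<Omega> v) w = L2_ip M g w" "L2_ip M w (weak_div \<Omega> v) = L2_ip M w g"
proof -
  have "weak_div \<Omega> v \<in> square_integrable M" "g \<in> square_integrable M"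
    using assms Hdiv_square_integrable(2)[of v] by (auto simp: Hdiv_def has_weak_div_iff)
  note L2_ip_cong_AE[OF this weak_div_AE_eq[OF assms(1)] assms(2)]
  then show "L2_ip M (weak_div \<Omega> v) w = L2_ip M g w" "L2_ip M w (weak_div \<Omega> v) = L2_ip M w g" by auto
qed

lemma has_weak_div_add:
  assumes "has_weak_div \<Omega> v g" "has_weak_div \<Omega> v' g'"
  shows "has_weak_div \<Omega> (v + v') (g + g')"
  using assms by (auto simp: has_weak_div_iff L2_space.ip_add_left smooth_square_integrable test_function_smooth)

lemma has_weak_div_scale:
  assumes "has_weak_div \<Omega> v g" shows "has_weak_div \<Omega> (c *\<^sub>R v) (c *\<^sub>R g)"
  using assms by (auto simp: has_weak_div_iff L2_space.ip_scale_left smooth_square_integrable test_function_smooth)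

lemma subspace_Hdiv: "subspace (Hdiv \<Omega>)"
proof (rule subspaceI)
  have "has_weak_div \<Omega> 0 0"
    using L2_space.ip_scale_left[of 0 M _ 0] by (auto simp: has_weak_div_iff L2_ip_def)
  then show "0 \<in> Hdiv \<Omega>" by (auto simp: Hdiv_def)
qed (auto simp: Hdiv_def intro: has_weak_div_add has_weak_div_scale)

lemma L2_ip_weak_div_add:
  assumes "v \<in> Hdiv \<Omega>" "v' \<in> Hdiv \<Omega>" "w \<in> square_integrable M"
  shows "L2_ip M (weak_div \<Omega> (v + v')) w = L2_ip M (weak_div \<Omega> v) w + L2_ip M (weak_div \<Omega> v') w"
  using L2_ip_weak_div_eq(1)[OF has_weak_div_add[OF weak_div weak_div] assms(3)] assms
  by (simp add: L2_space.ip_add_left Hdiv_square_integrable)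

lemma L2_ip_weak_div_scale:
  assumes "v \<in> Hdiv \<Omega>" "w \<in> square_integrable M"
  shows "L2_ip M (weak_div \<Omega> (c *\<^sub>R v)) w = c * L2_ip M (weak_div \<Omega> v) w"
  using L2_ip_weak_div_eq(1)[OF has_weak_div_scale[OF weak_div] assms(2)] assms
  by (simp add: L2_space.ip_scale_left Hdiv_square_integrable)

lemma weak_div_diff_AE:
  assumes "v \<in> Hdiv \<Omega>" "v' \<in> Hdiv \<Omega>"
  shows "AE x in M. weak_div \<Omega> (v - v') x = weak_div \<Omega> v x - weak_div \<Omega> v' x"
  using weak_div_AE_eq[OF has_weak_div_add[OF weak_div[OF assms(1)] has_weak_div_scale[OF weak_div[OF assms(2)], of "-1"]]]
  by simp

lemma L2_ip_self_cong_AE: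
  assumes "u \<in> square_integrable M" "v \<in> square_integrable M" "AE x in M. u x = v x"
  shows "L2_ip M u u = L2_ip M v v"
  using L2_ip_cong_AE[OF assms] assms by simp

section \<open>Boundary conditions and the graph inner product\<close>

lemma normal_trace_eq:
  assumes "v \<in> Hdiv \<Omega>" "smooth w"
  shows "normal_trace \<Omega> v w = L2_ip M v (grad w) + L2_ip M (weak_div \<Omega> v) w"
  using integrable_inner[OF Hdiv_square_integrable(1)[OF assms(1)] smooth_square_integrable(2)[OF assms(2)]]
    integrable_inner[OF Hdiv_square_integrable(2)[OF assms(1)] smooth_square_integrable(1)[OF assms(2)]]
  by (simp add: normal_trace_def L2_ip_def)

lemma Hdiv0_iff:
  "v \<in> Hdiv0 \<Omega> \<Gamma> \<longleftrightarrow> v \<in> Hdiv \<Omega> \<and> (\<forall>w. smooth w \<and> supp w \<inter> closure (frontier \<Omega> - \<Gamma>) = {} \<longrightarrow>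
     L2_ip M v (grad w) + L2_ip M (weak_div \<Omega> v) w = 0)"
  by (auto simp: Hdiv0_def normal_trace_eq)

lemma subspace_Hdiv0: "subspace (Hdiv0 \<Omega> \<Gamma>)"
proof (rule subspaceI)
  have "(0::real^'n \<Rightarrow> real^'n) \<in> Hdiv \<Omega>" using subspace_Hdiv by (rule subspace_0)
  moreover have "L2_ip M (weak_div \<Omega> 0) w = 0" if "smooth w" for w
    using L2_ip_weak_div_scale[OF \<open>0 \<in> Hdiv \<Omega>\<close> smooth_square_integrable(1)[OF that], of 0] by simp
  ultimately show "0 \<in> Hdiv0 \<Omega> \<Gamma>" by (auto simp: Hdiv0_iff L2_ip_def)
next
  fix u v assume uv: "u \<in> Hdiv0 \<Omega> \<Gamma>" "v \<in> Hdiv0 \<Omega> \<Gamma>"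
  then have mem: "u \<in> Hdiv \<Omega>" "v \<in> Hdiv \<Omega>" by (auto simp: Hdiv0_iff)
  have "L2_ip M (u + v) (grad w) + L2_ip M (weak_div \<Omega> (u + v)) w
      = (L2_ip M u (grad w) + L2_ip M (weak_div \<Omega> u) w) + (L2_ip M v (grad w) + L2_ip M (weak_div \<Omega> v) w)"
    if "smooth w" for w
    using mem smooth_square_integrable[OF that]
    by (simp add: L2_ip_weak_div_add L2_space.ip_add_left Hdiv_square_integrable)
  then show "u + v \<in> Hdiv0 \<Omega> \<Gamma>"
    using uv subspace_add[OF subspace_Hdiv mem] by (simp add: Hdiv0_iff)
next
  fix c u assume "u \<in> Hdiv0 \<Omega> \<Gamma>"
  then show "c *\<^sub>R u \<in> Hdiv0 \<Omega> \<Gamma>"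
    using subspace_scale[OF subspace_Hdiv, of u c]
    by (auto simp: Hdiv0_iff L2_ip_weak_div_scale L2_space.ip_scale_left Hdiv_square_integrable smooth_square_integrable
        simp flip: distrib_left)
qed

lemma Hdiv0_subset_Hdiv: "Hdiv0 \<Omega> \<Gamma> \<subseteq> Hdiv \<Omega>"
  by (auto simp: Hdiv0_def)

lemma Hdiv0_square_integrable:
  assumes "v \<in> Hdiv0 \<Omega> \<Gamma>" shows "v \<in> square_integrable M" "weak_div \<Omega> v \<in> square_integrable M"
  using assms Hdiv0_subset_Hdiv Hdiv_square_integrable by blast+

definition Hdiv_ip :: "(real^'n \<Rightarrow> real^'n) \<Rightarrow> (real^'n \<Rightarrow> real^'n) \<Rightarrow> real" where
  "Hdiv_ip v w = L2_ip M v w + L2_ip M (weak_div \<Omega> v) (weak_div \<Omega> w)"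

lemma semi_inner_space_Hdiv: "semi_inner_space (Hdiv \<Omega>) Hdiv_ip"
proof
  show "subspace (Hdiv \<Omega>)" by (rule subspace_Hdiv)
  show "Hdiv_ip x y = Hdiv_ip y x" if "x \<in> Hdiv \<Omega>" "y \<in> Hdiv \<Omega>" for x y
    using that Hdiv_square_integrable by (metis Hdiv_ip_def L2_space.ip_commute)
qed (auto simp: Hdiv_ip_def L2_ip_weak_div_add L2_ip_weak_div_scale L2_space.ip_add_left L2_space.ip_scale_left
    Hdiv_square_integrable L2_space.ip_nonneg algebra_simps)

text \<open>The definition of the weak divergence and the boundary condition are identities of the
  same kind: a fixed smooth function and its gradient are paired with the divergence and the field.
  Both therefore pass to the limit.\<close>

lemma closed_Hdiv0:
  assumes X: "\<And>n. X n \<in> Hdiv0 \<Omega> \<Gamma>" and v: "v \<in> square_integrable M" and g: "g \<in> square_integrable M"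
    and Xv: "(\<lambda>n. L2_ip M (X n - v) (X n - v)) \<longlonglongrightarrow> 0"
    and Xg: "(\<lambda>n. L2_ip M (weak_div \<Omega> (X n) - g) (weak_div \<Omega> (X n) - g)) \<longlonglongrightarrow> 0"
  shows "has_weak_div \<Omega> v g" "v \<in> Hdiv0 \<Omega> \<Gamma>"
proof -
  note X2 = Hdiv0_square_integrable[OF X]
  have lim: "(\<lambda>n. L2_ip M (X n) (grad w)) \<longlonglongrightarrow> L2_ip M v (grad w)"
    "(\<lambda>n. L2_ip M (weak_div \<Omega> (X n)) w) \<longlonglongrightarrow> L2_ip M g w" if "smooth w" for w
    using L2_space.tendsto_ip[OF X2(1) v smooth_square_integrable(2)[OF that] Xv]
      L2_space.tendsto_ip[OF X2(2) g smooth_square_integrable(1)[OF that] Xg] by auto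
  have lim_sum: "L2_ip M v (grad w) + L2_ip M g w = 0"
    if "smooth w" and 0: "\<And>n. L2_ip M (X n) (grad w) + L2_ip M (weak_div \<Omega> (X n)) w = 0" for w
    using tendsto_add[OF lim[OF that(1)]] unfolding 0 by (simp add: LIMSEQ_const_iff)
  have "L2_ip M v (grad \<phi>) = - L2_ip M g \<phi>" if \<phi>: "\<phi> \<in> test_functions \<Omega>" for \<phi>
  proof -
    have "L2_ip M (X n) (grad \<phi>) + L2_ip M (weak_div \<Omega> (X n)) \<phi> = 0" for n
      using weak_div[of "X n"] X[of n] Hdiv0_subset_Hdiv[of \<Gamma>] \<phi> unfolding has_weak_div_iff by fastforce
    from lim_sum[OF test_function_smooth[OF \<phi>] this] show ?thesis by simp
  qed
  then show wd: "has_weak_div \<Omega> v g" using v g by (simp add: has_weak_div_iff)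
  have "L2_ip M v (grad w) + L2_ip M (weak_div \<Omega> v) w = 0"
    if "smooth w" "supp w \<inter> closure (frontier \<Omega> - \<Gamma>) = {}" for w
    unfolding L2_ip_weak_div_eq(1)[OF wd smooth_square_integrable(1)[OF that(1)]]
    using X that by (intro lim_sum) (auto simp: Hdiv0_iff)
  then show "v \<in> Hdiv0 \<Omega> \<Gamma>" using wd by (auto simp: Hdiv0_iff Hdiv_def)
qed

text \<open>A Cauchy sequence for the graph inner product gives one of fields and one of
  divergences; closedness reunites the two limits.\<close>

lemma semi_hilbert_space_Hdiv0: "semi_hilbert_space (Hdiv0 \<Omega> \<Gamma>) Hdiv_ip"
proof -
  interpret I: semi_inner_space "Hdiv \<Omega>" Hdiv_ip by (rule semi_inner_space_Hdiv)
  interpret semi_inner_space "Hdiv0 \<Omega> \<Gamma>" Hdiv_ip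
    by unfold_locales
      (use Hdiv0_subset_Hdiv subspace_Hdiv0 in \<open>auto intro: I.ip_add_left I.ip_scale_left I.ip_commute I.ip_nonneg\<close>)
  show ?thesis
  proof
    fix X :: "nat \<Rightarrow> real^'n \<Rightarrow> real^'n"
    assume X: "\<And>n. X n \<in> Hdiv0 \<Omega> \<Gamma>"
      and cau: "\<And>e. e > 0 \<Longrightarrow> \<exists>N. \<forall>m\<ge>N. \<forall>n\<ge>N. Hdiv_ip (X m - X n) (X m - X n) < e"
    note X2 = Hdiv0_square_integrable[OF X]
    \<comment> \<open>The divergence of the difference and the difference of the divergences come
      from separate choices and agree only almost everywhere.\<close>
    have split: "Hdiv_ip (X m - X n) (X m - X n) = L2_ip M (X m - X n) (X m - X n)
        + L2_ip M (weak_div \<Omega> (X m) - weak_div \<Omega> (X n)) (weak_div \<Omega> (X m) - weak_div \<Omega> (X n))" for m n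
    proof -
      have "X m - X n \<in> Hdiv0 \<Omega> \<Gamma>" using X by blast
      then have "L2_ip M (weak_div \<Omega> (X m - X n)) (weak_div \<Omega> (X m - X n))
        = L2_ip M (weak_div \<Omega> (X m) - weak_div \<Omega> (X n)) (weak_div \<Omega> (X m) - weak_div \<Omega> (X n))"
        using X2 X[THEN subsetD[OF Hdiv0_subset_Hdiv]] weak_div_diff_AE[of "X m" "X n"]
        by (intro L2_ip_self_cong_AE) (auto intro: Hdiv0_square_integrable)
      then show ?thesis by (simp add: Hdiv_ip_def)
    qed
    have nonneg: "0 \<le> L2_ip M (X m - X n) (X m - X n)"
      "0 \<le> L2_ip M (weak_div \<Omega> (X m) - weak_div \<Omega> (X n)) (weak_div \<Omega> (X m) - weak_div \<Omega> (X n))" for m n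
      using X2 by (auto intro!: L2_space.ip_nonneg)
    have "\<exists>v\<in>square_integrable M. (\<lambda>n. L2_ip M (X n - v) (X n - v)) \<longlonglongrightarrow> 0"
    proof (rule L2_complete[OF X2(1)])
      fix e :: real assume "e > 0"
      then obtain N where N: "\<forall>m\<ge>N. \<forall>n\<ge>N. Hdiv_ip (X m - X n) (X m - X n) < e" using cau by blast
      have "L2_ip M (X m - X n) (X m - X n) < e" if "m \<ge> N" "n \<ge> N" for m n
      proof -
        have "Hdiv_ip (X m - X n) (X m - X n) < e" using N that by blast
        then show ?thesis using nonneg[of m n] split[of m n] by linarith
      qed
      then show "\<exists>N. \<forall>m\<ge>N. \<forall>n\<ge>N. L2_ip M (X m - X n) (X m - X n) < e" by blast
    qed
    moreover have "\<exists>g\<in>square_integrable M. (\<lambda>n. L2_ip M (weak_div \<Omega> (X n) - g) (weak_div \<Omega> (X n) - g)) \<longlonglongrightarrow> 0"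
    proof (rule L2_complete[OF X2(2)])
      fix e :: real assume "e > 0"
      then obtain N where N: "\<forall>m\<ge>N. \<forall>n\<ge>N. Hdiv_ip (X m - X n) (X m - X n) < e" using cau by blast
      have "L2_ip M (weak_div \<Omega> (X m) - weak_div \<Omega> (X n)) (weak_div \<Omega> (X m) - weak_div \<Omega> (X n)) < e" if "m \<ge> N" "n \<ge> N" for m n
      proof -
        have "Hdiv_ip (X m - X n) (X m - X n) < e" using N that by blast
        then show ?thesis using nonneg[of m n] split[of m n] by linarith
      qed
      then show "\<exists>N. \<forall>m\<ge>N. \<forall>n\<ge>N. L2_ip M (weak_div \<Omega> (X m) - weak_div \<Omega> (X n)) (weak_div \<Omega> (X m) - weak_div \<Omega> (X n)) < e"
        by blast
    qed
    ultimately obtain v g where v: "v \<in> square_integrable M" and g: "g \<in> square_integrable M"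
      and Xv: "(\<lambda>n. L2_ip M (X n - v) (X n - v)) \<longlonglongrightarrow> 0"
      and Xg: "(\<lambda>n. L2_ip M (weak_div \<Omega> (X n) - g) (weak_div \<Omega> (X n) - g)) \<longlonglongrightarrow> 0" by blast
    note vg = closed_Hdiv0[OF X v g Xv Xg]
    have "Hdiv_ip (X n - v) (X n - v)
        = L2_ip M (X n - v) (X n - v) + L2_ip M (weak_div \<Omega> (X n) - g) (weak_div \<Omega> (X n) - g)" for n
    proof -
      have Xn: "X n - v \<in> Hdiv0 \<Omega> \<Gamma>" using X vg(2) by blast
      have "AE x in M. weak_div \<Omega> (X n - v) x = weak_div \<Omega> (X n) x - weak_div \<Omega> v x"
        using X vg Hdiv0_subset_Hdiv by (intro weak_div_diff_AE) auto
      then have "AE x in M. weak_div \<Omega> (X n - v) x = (weak_div \<Omega> (X n) - g) x"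
        using weak_div_AE_eq[OF vg(1)] by eventually_elim simp
      then have "L2_ip M (weak_div \<Omega> (X n - v)) (weak_div \<Omega> (X n - v))
        = L2_ip M (weak_div \<Omega> (X n) - g) (weak_div \<Omega> (X n) - g)"
        using X2 g Hdiv0_square_integrable[OF Xn] by (intro L2_ip_self_cong_AE) auto
      then show ?thesis by (simp add: Hdiv_ip_def)
    qed
    then have "(\<lambda>n. Hdiv_ip (X n - v) (X n - v)) \<longlonglongrightarrow> 0"
      using tendsto_add[OF Xv Xg] by simp
    then show "\<exists>v\<in>Hdiv0 \<Omega> \<Gamma>. (\<lambda>n. Hdiv_ip (X n - v) (X n - v)) \<longlonglongrightarrow> 0" using vg(2) by blast
  qed
qed

text \<open>A larger \<open>\<Gamma>\<close> leaves less of the boundary for \<open>w\<close> to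
  avoid, so more functions \<open>w\<close> impose a condition.\<close>

lemma Hdiv0_mono:
  assumes "\<Gamma> \<subseteq> \<Gamma>'" shows "Hdiv0 \<Omega> \<Gamma>' \<subseteq> Hdiv0 \<Omega> \<Gamma>"
proof -
  have "closure (frontier \<Omega> - \<Gamma>') \<subseteq> closure (frontier \<Omega> - \<Gamma>)"
    using assms by (intro closure_mono) auto
  then show ?thesis by (auto simp: Hdiv0_def)
qed

end

section \<open>The mixed problem\<close>

context bounded_open_set
begin

lemma form_a_eq:
  "form_a c\<^sub>0 c\<^sub>1 \<Omega> x y = c\<^sub>0 * L2_ip M (snd x) (snd y)
     + L2_ip M (weak_div \<Omega> (snd x)) (weak_div \<Omega> (snd y)) + c\<^sub>1 * L2_ip M (fst x) (fst y)"
  by (simp add: form_a_def L2_ip_def case_prod_beta)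

lemma form_b_eq:
  assumes "x \<in> square_integrable M \<times> square_integrable M" "\<beta> \<in> Hdiv \<Omega>"
  shows "form_b \<Omega> x \<beta> = L2_ip M \<beta> (snd x) + L2_ip M (fst x) (weak_div \<Omega> \<beta>)"
proof -
  have "integrable M (\<lambda>t. \<beta> t \<bullet> snd x t)" "integrable M (\<lambda>t. fst x t \<bullet> weak_div \<Omega> \<beta> t)"
    using assms(1) Hdiv_square_integrable[OF assms(2)] by (intro integrable_inner; simp add: mem_Times_iff)+
  then show ?thesis by (simp add: form_b_def L2_ip_def case_prod_beta)
qed

lemma form_b_add_left:
  assumes "x \<in> square_integrable M \<times> square_integrable M" "x' \<in> square_integrable M \<times> square_integrable M"
    and "\<beta> \<in> Hdiv \<Omega>"
  shows "form_b \<Omega> (x + x') \<beta> = form_b \<Omega> x \<beta> + form_b \<Omega> x' \<beta>"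
proof -
  have "x + x' \<in> square_integrable M \<times> square_integrable M"
    using assms by (auto simp: mem_Times_iff)
  then show ?thesis
    using assms Hdiv_square_integrable[OF assms(3)] by (auto simp: form_b_eq L2_space.ip_simps)
qed

lemma form_b_scale_left:
  assumes "x \<in> square_integrable M \<times> square_integrable M" "\<beta> \<in> Hdiv \<Omega>"
  shows "form_b \<Omega> (c *\<^sub>R x) \<beta> = c * form_b \<Omega> x \<beta>"
proof -
  have "c *\<^sub>R x \<in> square_integrable M \<times> square_integrable M"
    using assms by (auto simp: mem_Times_iff)
  then show ?thesis
    using assms Hdiv_square_integrable[OF assms(2)] by (auto simp: form_b_eq L2_space.ip_simps algebra_simps)
qed

lemma form_b_add_right:
  assumes "x \<in> square_integrable M \<times> square_integrable M" "\<beta> \<in> Hdiv \<Omega>" "\<beta>' \<in> Hdiv \<Omega>"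
  shows "form_b \<Omega> x (\<beta> + \<beta>') = form_b \<Omega> x \<beta> + form_b \<Omega> x \<beta>'"
proof -
  have mem: "fst x \<in> square_integrable M" "snd x \<in> square_integrable M" using assms(1) by auto
  have sum: "\<beta> + \<beta>' \<in> Hdiv \<Omega>" using assms(2,3) by (intro subspace_add subspace_Hdiv)
  have "L2_ip M (fst x) (weak_div \<Omega> (\<beta> + \<beta>')) = L2_ip M (fst x) (weak_div \<Omega> \<beta>) + L2_ip M (fst x) (weak_div \<Omega> \<beta>')"
    using L2_ip_weak_div_add[OF assms(2,3) mem(1)] mem(1) assms(2,3) sum
    by (simp add: L2_space.ip_commute[of "fst x"] Hdiv_square_integrable)
  then show ?thesis
    using assms mem sum by (simp add: form_b_eq L2_space.ip_add_left Hdiv_square_integrable)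
qed

lemma form_b_scale_right:
  assumes "x \<in> square_integrable M \<times> square_integrable M" "\<beta> \<in> Hdiv \<Omega>"
  shows "form_b \<Omega> x (c *\<^sub>R \<beta>) = c * form_b \<Omega> x \<beta>"
proof -
  have mem: "fst x \<in> square_integrable M" "snd x \<in> square_integrable M" using assms(1) by auto
  have scale: "c *\<^sub>R \<beta> \<in> Hdiv \<Omega>" using assms(2) by (intro subspace_scale subspace_Hdiv)
  have "L2_ip M (fst x) (weak_div \<Omega> (c *\<^sub>R \<beta>)) = c * L2_ip M (fst x) (weak_div \<Omega> \<beta>)"
    using L2_ip_weak_div_scale[OF assms(2) mem(1)] mem(1) assms(2) scale
    by (simp add: L2_space.ip_commute[of "fst x"] Hdiv_square_integrable)
  then show ?thesis
    using assms mem scale by (simp add: form_b_eq L2_space.ip_scale_left Hdiv_square_integrable algebra_simps)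
qed

section \<open>Continuity, coercivity and the inf-sup condition\<close>

context
  fixes c\<^sub>0 c\<^sub>1 :: real
  assumes c\<^sub>0: "c\<^sub>0 > 0" and c\<^sub>1: "c\<^sub>1 > 0"
begin

text \<open>Coercivity in separated form, as each term is one of three nonnegative summands; the
  constants below that involve reciprocals of \<open>c\<^sub>0\<close> and \<open>c\<^sub>1\<close>
  come from it.\<close>

lemma form_a_ge:
  assumes "u \<in> square_integrable M" "v \<in> Hdiv \<Omega>"
  shows "c\<^sub>0 * L2_ip M v v \<le> form_a c\<^sub>0 c\<^sub>1 \<Omega> (u, v) (u, v)"
    and "c\<^sub>1 * L2_ip M u u \<le> form_a c\<^sub>0 c\<^sub>1 \<Omega> (u, v) (u, v)"
    and "L2_ip M (weak_div \<Omega> v) (weak_div \<Omega> v) \<le> form_a c\<^sub>0 c\<^sub>1 \<Omega> (u, v) (u, v)"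
proof -
  have "0 \<le> c\<^sub>0 * L2_ip M v v" "0 \<le> c\<^sub>1 * L2_ip M u u" "0 \<le> L2_ip M (weak_div \<Omega> v) (weak_div \<Omega> v)"
    using assms c\<^sub>0 c\<^sub>1 by (auto intro!: mult_nonneg_nonneg L2_space.ip_nonneg Hdiv_square_integrable)
  then show "c\<^sub>0 * L2_ip M v v \<le> form_a c\<^sub>0 c\<^sub>1 \<Omega> (u, v) (u, v)"
    "c\<^sub>1 * L2_ip M u u \<le> form_a c\<^sub>0 c\<^sub>1 \<Omega> (u, v) (u, v)"
    "L2_ip M (weak_div \<Omega> v) (weak_div \<Omega> v) \<le> form_a c\<^sub>0 c\<^sub>1 \<Omega> (u, v) (u, v)"
    unfolding form_a_eq by (simp_all add: add_nonneg_nonneg)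
qed

lemma semi_hilbert_space_form_a:
  "semi_hilbert_space (square_integrable M \<times> Hdiv0 \<Omega> \<Gamma>) (form_a c\<^sub>0 c\<^sub>1 \<Omega>)"
proof -
  let ?X = "(square_integrable M :: (real^'n \<Rightarrow> real) set) \<times> Hdiv0 \<Omega> \<Gamma>"
  interpret P: semi_hilbert_space ?X
    "\<lambda>x y. L2_ip M (fst x) (fst y) + Hdiv_ip (snd x) (snd y)"
    by (intro semi_hilbert_space_Times semi_hilbert_space_Hdiv0 semi_hilbert_space_L2)
  interpret Q: semi_inner_space "Hdiv \<Omega>" Hdiv_ip by (rule semi_inner_space_Hdiv)
  have mem: "fst x \<in> square_integrable M" "snd x \<in> Hdiv \<Omega>" if "x \<in> ?X" for x
    using that subsetD[OF Hdiv0_subset_Hdiv] by auto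
  show ?thesis
  proof (rule P.semi_hilbert_space_equivalent)
    show "semi_inner_space ?X (form_a c\<^sub>0 c\<^sub>1 \<Omega>)"
    proof
      show "subspace ?X" by (rule P.subspace)
      fix x y assume x: "x \<in> ?X" and y: "y \<in> ?X"
      note mx = mem[OF x] Hdiv_square_integrable[OF mem(2)[OF x]] and my = mem[OF y] Hdiv_square_integrable[OF mem(2)[OF y]]
      show "form_a c\<^sub>0 c\<^sub>1 \<Omega> (c *\<^sub>R x) y = c * form_a c\<^sub>0 c\<^sub>1 \<Omega> x y" for c
        using mx my by (simp add: form_a_eq L2_space.ip_scale_left L2_ip_weak_div_scale algebra_simps)
      show "form_a c\<^sub>0 c\<^sub>1 \<Omega> x y = form_a c\<^sub>0 c\<^sub>1 \<Omega> y x"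
        using mx my by (simp add: form_a_eq L2_space.ip_commute[of _ M "_ y"] L2_space.ip_commute[of _ M "weak_div \<Omega> (snd y)"])
      show "0 \<le> form_a c\<^sub>0 c\<^sub>1 \<Omega> x x"
        using mx c\<^sub>0 c\<^sub>1 by (auto simp: form_a_eq intro!: add_nonneg_nonneg mult_nonneg_nonneg L2_space.ip_nonneg)
      fix z assume "z \<in> ?X"
      note mz = mem[OF this] Hdiv_square_integrable[OF mem(2)[OF this]]
      show "form_a c\<^sub>0 c\<^sub>1 \<Omega> (x + y) z = form_a c\<^sub>0 c\<^sub>1 \<Omega> x z + form_a c\<^sub>0 c\<^sub>1 \<Omega> y z"
        using mx my mz by (simp add: form_a_eq L2_space.ip_add_left L2_ip_weak_div_add algebra_simps)
    qed
  next
    fix x assume x: "x \<in> ?X"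
    note mx = mem[OF x] Hdiv_square_integrable[OF mem(2)[OF x]]
    have nn: "0 \<le> L2_ip M (fst x) (fst x)" "0 \<le> L2_ip M (snd x) (snd x)"
      "0 \<le> L2_ip M (weak_div \<Omega> (snd x)) (weak_div \<Omega> (snd x))"
      using mx by (auto intro: L2_space.ip_nonneg)
    \<comment> \<open>Each of the weights \<open>c\<^sub>0\<close>, 1 and \<open>c\<^sub>1\<close>
      is at most their sum.\<close>
    show "form_a c\<^sub>0 c\<^sub>1 \<Omega> x x \<le> (c\<^sub>0 + c\<^sub>1 + 1) * (L2_ip M (fst x) (fst x) + Hdiv_ip (snd x) (snd x))"
      using nn c\<^sub>0 c\<^sub>1 by (simp add: form_a_eq Hdiv_ip_def algebra_simps add_nonneg_nonneg add_increasing add_increasing2)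
    have "L2_ip M (fst x) (fst x) \<le> form_a c\<^sub>0 c\<^sub>1 \<Omega> x x / c\<^sub>1" "L2_ip M (snd x) (snd x) \<le> form_a c\<^sub>0 c\<^sub>1 \<Omega> x x / c\<^sub>0"
      "L2_ip M (weak_div \<Omega> (snd x)) (weak_div \<Omega> (snd x)) \<le> form_a c\<^sub>0 c\<^sub>1 \<Omega> x x"
      using form_a_ge[OF mx(1,2)] c\<^sub>0 c\<^sub>1 by (simp_all add: field_simps)
    then show "L2_ip M (fst x) (fst x) + Hdiv_ip (snd x) (snd x) \<le> (1 / c\<^sub>1 + 1 / c\<^sub>0 + 1) * form_a c\<^sub>0 c\<^sub>1 \<Omega> x x"
      by (simp add: Hdiv_ip_def algebra_simps)
  qed
qed

text \<open>Cauchy-Schwarz for each of the two integrals; measuring the pair by \<open>a\<close>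
  costs \<open>1 / sqrt c\<^sub>0\<close> for the field and \<open>1 / sqrt c\<^sub>1\<close> for
  the scalar part.\<close>

lemma form_b_bound:
  assumes "x \<in> square_integrable M \<times> Hdiv \<Omega>" "\<beta> \<in> Hdiv \<Omega>"
  shows "\<bar>form_b \<Omega> x \<beta>\<bar> \<le> (1 / sqrt c\<^sub>0 + 1 / sqrt c\<^sub>1) * sqrt (form_a c\<^sub>0 c\<^sub>1 \<Omega> x x) * sqrt (Hdiv_ip \<beta> \<beta>)"
proof -
  obtain u v where x: "x = (u, v)" and u: "u \<in> square_integrable M" and v: "v \<in> Hdiv \<Omega>" using assms by auto
  note v2 = Hdiv_square_integrable[OF v] and \<beta> = Hdiv_square_integrable[OF assms(2)]
  let ?a = "sqrt (form_a c\<^sub>0 c\<^sub>1 \<Omega> x x)" and ?p = "sqrt (Hdiv_ip \<beta> \<beta>)"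
  have "sqrt (c\<^sub>0 * L2_ip M v v) \<le> ?a" "sqrt (c\<^sub>1 * L2_ip M u u) \<le> ?a"
    using form_a_ge[OF u v] by (auto simp: x intro: real_sqrt_le_mono)
  then have a: "sqrt (L2_ip M v v) \<le> 1 / sqrt c\<^sub>0 * ?a" "sqrt (L2_ip M u u) \<le> 1 / sqrt c\<^sub>1 * ?a"
    using c\<^sub>0 c\<^sub>1 by (simp_all add: real_sqrt_mult field_simps)
  have p: "sqrt (L2_ip M \<beta> \<beta>) \<le> ?p" "sqrt (L2_ip M (weak_div \<Omega> \<beta>) (weak_div \<Omega> \<beta>)) \<le> ?p"
    using \<beta> by (auto simp: Hdiv_ip_def L2_space.ip_nonneg)
  have "\<bar>form_b \<Omega> x \<beta>\<bar> \<le> \<bar>L2_ip M \<beta> v\<bar> + \<bar>L2_ip M u (weak_div \<Omega> \<beta>)\<bar>"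
    using u v2 assms(2) by (subst form_b_eq) (auto simp: x)
  also have "\<dots> \<le> sqrt (L2_ip M v v) * sqrt (L2_ip M \<beta> \<beta>)
      + sqrt (L2_ip M u u) * sqrt (L2_ip M (weak_div \<Omega> \<beta>) (weak_div \<Omega> \<beta>))"
    using L2_space.Cauchy_Schwarz[OF \<beta>(1) v2(1)] L2_space.Cauchy_Schwarz[OF u \<beta>(2)] by (simp add: mult.commute)
  also have "\<dots> \<le> (1 / sqrt c\<^sub>0 * ?a) * ?p + (1 / sqrt c\<^sub>1 * ?a) * ?p"
    using u v2 \<beta> by (intro add_mono mult_mono a p order_trans[OF _ a(1)] order_trans[OF _ a(2)] real_sqrt_ge_zero L2_space.ip_nonneg)
  finally show ?thesis by (simp add: algebra_simps)
qed

text \<open>On this pair the field meets itself and the divergence meets itself, so \<open>b\<close>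
  becomes the squared graph norm; \<open>a\<close> contains the same two terms with weights
  \<open>c\<^sub>0\<close> and \<open>1 + c\<^sub>1\<close>.\<close>

lemma form_b_inf_sup:
  assumes "\<beta> \<in> Hdiv \<Omega>"
  shows "form_a c\<^sub>0 c\<^sub>1 \<Omega> (weak_div \<Omega> \<beta>, \<beta>) (weak_div \<Omega> \<beta>, \<beta>) \<le> (c\<^sub>0 + 1 + c\<^sub>1) * Hdiv_ip \<beta> \<beta>"
    and "form_b \<Omega> (weak_div \<Omega> \<beta>, \<beta>) \<beta> = Hdiv_ip \<beta> \<beta>"
proof -
  note \<beta> = Hdiv_square_integrable[OF assms]
  have "0 \<le> L2_ip M \<beta> \<beta>" "0 \<le> L2_ip M (weak_div \<Omega> \<beta>) (weak_div \<Omega> \<beta>)"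
    using \<beta> by (auto intro: L2_space.ip_nonneg)
  then show "form_a c\<^sub>0 c\<^sub>1 \<Omega> (weak_div \<Omega> \<beta>, \<beta>) (weak_div \<Omega> \<beta>, \<beta>) \<le> (c\<^sub>0 + 1 + c\<^sub>1) * Hdiv_ip \<beta> \<beta>"
    using c\<^sub>0 c\<^sub>1 by (simp add: form_a_eq Hdiv_ip_def algebra_simps add_nonneg_nonneg)
  show "form_b \<Omega> (weak_div \<Omega> \<beta>, \<beta>) \<beta> = Hdiv_ip \<beta> \<beta>"
    using \<beta> assms by (subst form_b_eq) (auto simp: Hdiv_ip_def)
qed

theorem saddle_point_well_posed:
  assumes F: "bounded_linear_functional_on (L2 \<Omega>) (L2_norm \<Omega>) F"
  shows "\<exists>u v \<alpha>. saddle_point_solution c\<^sub>0 c\<^sub>1 \<Omega> \<Gamma>\<^sub>2 \<Gamma>\<^sub>3 F u v \<alpha> \<and>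
           (\<forall>u' v' \<alpha>'. saddle_point_solution c\<^sub>0 c\<^sub>1 \<Omega> \<Gamma>\<^sub>2 \<Gamma>\<^sub>3 F u' v' \<alpha>' \<longrightarrow>
              (AE x in M. u' x = u x \<and> v' x = v x \<and> \<alpha>' x = \<alpha> x))"
proof -
  define X :: "((real^'n \<Rightarrow> real) \<times> (real^'n \<Rightarrow> real^'n)) set" where "X = square_integrable M \<times> Hdiv0 \<Omega> \<Gamma>\<^sub>3"
  define Y where "Y = Hdiv0 \<Omega> (\<Gamma>\<^sub>2 \<union> \<Gamma>\<^sub>3)"
  let ?a = "form_a c\<^sub>0 c\<^sub>1 \<Omega>" and ?b = "form_b \<Omega>" and ?l = "\<lambda>x. F (fst x)"
  have Y_sub: "Y \<subseteq> Hdiv0 \<Omega> \<Gamma>\<^sub>3" unfolding Y_def by (rule Hdiv0_mono) auto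
  have X: "x \<in> square_integrable M \<times> Hdiv \<Omega>" "x \<in> square_integrable M \<times> square_integrable M" if "x \<in> X" for x
    using that subsetD[OF Hdiv0_subset_Hdiv] Hdiv0_square_integrable by (auto simp: X_def)
  have Y: "y \<in> Hdiv \<Omega>" if "y \<in> Y" for y using that subsetD[OF Hdiv0_subset_Hdiv] by (auto simp: Y_def)
  have hX: "semi_hilbert_space X ?a" unfolding X_def by (rule semi_hilbert_space_form_a)
  have hY: "semi_hilbert_space Y Hdiv_ip" unfolding Y_def by (rule semi_hilbert_space_Hdiv0)
  interpret X: semi_hilbert_space X ?a by (rule hX)
  interpret Y: semi_hilbert_space Y Hdiv_ip by (rule hY)
  note b_add_left = form_b_add_left[OF X(2) X(2) Y] and b_scale_left = form_b_scale_left[OF X(2) Y]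
    and b_add_right = form_b_add_right[OF X(2) Y Y] and b_scale_right = form_b_scale_right[OF X(2) Y]
  have inf_sup: "\<exists>x\<in>X. ?a x x \<le> (c\<^sub>0 + 1 + c\<^sub>1) * Hdiv_ip y y \<and> Hdiv_ip y y \<le> ?b x y" if y: "y \<in> Y" for y
    using form_b_inf_sup[OF Y[OF y]] Hdiv_square_integrable(2)[OF Y[OF y]] y Y_sub
    by (intro bexI[of _ "(weak_div \<Omega> y, y)"]) (auto simp: X_def)
  have F_add: "F (u + v) = F u + F v" if "u \<in> square_integrable M" "v \<in> square_integrable M" for u v
    using F that by (simp add: bounded_linear_functional_on_def L2_eq plus_fun_def)
  have F_scale: "F (c *\<^sub>R u) = c * F u" if "u \<in> square_integrable M" for u c
    using F that by (simp add: bounded_linear_functional_on_def L2_eq scaleR_fun_def)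
  obtain C where C: "\<And>u. u \<in> square_integrable M \<Longrightarrow> \<bar>F u\<bar> \<le> C * L2_norm \<Omega> u"
    using F unfolding bounded_linear_functional_on_def L2_eq by blast
  \<comment> \<open>The load sees only the scalar component, which \<open>a\<close> controls through
    \<open>c\<^sub>1\<close>. The absolute value is taken since \<open>C\<close> may be
    negative.\<close>
  have F_bound: "\<bar>F (fst x)\<bar> \<le> (\<bar>C\<bar> / sqrt c\<^sub>1) * sqrt (?a x x)" if xX: "x \<in> X" for x
  proof -
    obtain u v where x: "x = (u, v)" "u \<in> square_integrable M" "v \<in> Hdiv \<Omega>" using X(1)[OF xX] by auto
    have "L2_norm \<Omega> u = sqrt (L2_ip M u u)" by (simp add: L2_norm_def L2_ip_def power2_eq_square)
    moreover have "sqrt (c\<^sub>1 * L2_ip M u u) \<le> sqrt (?a x x)"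
      using form_a_ge(2)[OF x(2,3)] by (auto simp: x intro: real_sqrt_le_mono)
    ultimately have n: "L2_norm \<Omega> u \<le> sqrt (?a x x) / sqrt c\<^sub>1" "0 \<le> L2_norm \<Omega> u"
      using c\<^sub>1 x(2) by (simp_all add: real_sqrt_mult field_simps L2_space.ip_nonneg)
    have "\<bar>F (fst x)\<bar> \<le> C * L2_norm \<Omega> u" using C x by simp
    also have "\<dots> \<le> \<bar>C\<bar> * L2_norm \<Omega> u" using n by (intro mult_right_mono) auto
    also have "\<dots> \<le> \<bar>C\<bar> * (sqrt (?a x x) / sqrt c\<^sub>1)" using n by (intro mult_left_mono) auto
    finally show ?thesis by simp
  qed
  \<comment> \<open>The problem quantifies over all test elements jointly. Since 0 belongs to both
    spaces, the two equations can be separated.\<close>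
  have solution_iff: "saddle_point_solution c\<^sub>0 c\<^sub>1 \<Omega> \<Gamma>\<^sub>2 \<Gamma>\<^sub>3 F u v \<alpha> \<longleftrightarrow>
      (u, v) \<in> X \<and> \<alpha> \<in> Y \<and> (\<forall>x'\<in>X. ?a (u, v) x' + ?b x' \<alpha> = ?l x') \<and> (\<forall>y'\<in>Y. ?b (u, v) y' = 0)" for u v \<alpha>
    using X.mem_zero Y.mem_zero unfolding saddle_point_solution_def X_def Y_def L2_eq by (auto simp: zero_prod_def)
  have "\<exists>x\<in>X. \<exists>y\<in>Y. (\<forall>x'\<in>X. ?a x x' + ?b x' y = ?l x') \<and> (\<forall>y'\<in>Y. ?b x y' = 0)"
  proof (rule saddle_point_existence[where b = ?b and l = ?l and K = "c\<^sub>0 + 1 + c\<^sub>1", OF hX hY b_add_left b_scale_left b_add_right b_scale_right form_b_bound[OF X(1) Y] inf_sup])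
    show "\<bar>F (fst x)\<bar> \<le> (\<bar>C\<bar> / sqrt c\<^sub>1) * sqrt (?a x x)" if "x \<in> X" for x using that by (rule F_bound)
  qed (auto simp: X_def F_add F_scale)
  then obtain u v \<alpha> where sol: "saddle_point_solution c\<^sub>0 c\<^sub>1 \<Omega> \<Gamma>\<^sub>2 \<Gamma>\<^sub>3 F u v \<alpha>"
    unfolding solution_iff by auto
  moreover have "AE x in M. u' x = u x \<and> v' x = v x \<and> \<alpha>' x = \<alpha> x"
    if sol': "saddle_point_solution c\<^sub>0 c\<^sub>1 \<Omega> \<Gamma>\<^sub>2 \<Gamma>\<^sub>3 F u' v' \<alpha>'" for u' v' \<alpha>'
  proof -
    note s = sol[unfolded solution_iff] and s' = sol'[unfolded solution_iff]
    have "?a ((u', v') - (u, v)) ((u', v') - (u, v)) = 0 \<and> Hdiv_ip (\<alpha>' - \<alpha>) (\<alpha>' - \<alpha>) = 0"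
      by (rule saddle_point_uniqueness[where b = ?b and K = "c\<^sub>0 + 1 + c\<^sub>1", OF X.semi_inner_space_axioms Y.semi_inner_space_axioms b_add_left b_add_right inf_sup])
        (use s s' in auto)
    then have a0: "?a (u' - u, v' - v) (u' - u, v' - v) = 0" and p0: "Hdiv_ip (\<alpha>' - \<alpha>) (\<alpha>' - \<alpha>) = 0" by auto
    have "(u', v') - (u, v) \<in> X" "\<alpha>' - \<alpha> \<in> Y" using s s' by blast+
    then have d: "u' - u \<in> square_integrable M" "v' - v \<in> Hdiv \<Omega>" "\<alpha>' - \<alpha> \<in> Hdiv \<Omega>"
      using X(1)[of "(u' - u, v' - v)"] Y by auto
    note d2 = Hdiv_square_integrable[OF d(2)] Hdiv_square_integrable[OF d(3)]
    \<comment> \<open>A vanishing seminorm of the difference makes the \<open>L2\<close> norm of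
      each component vanish, hence each component is 0 almost everywhere.\<close>
    have u0: "L2_ip M (u' - u) (u' - u) = 0"
      using form_a_ge(2)[OF d(1,2)] a0 c\<^sub>1 L2_space.ip_nonneg[OF d(1)] by (simp add: mult_le_0_iff)
    have v0: "L2_ip M (v' - v) (v' - v) = 0"
      using form_a_ge(1)[OF d(1,2)] a0 c\<^sub>0 L2_space.ip_nonneg[OF d2(1)] by (simp add: mult_le_0_iff)
    have \<alpha>0: "L2_ip M (\<alpha>' - \<alpha>) (\<alpha>' - \<alpha>) = 0"
      using p0 L2_space.ip_nonneg[OF d2(3)] L2_space.ip_nonneg[OF d2(4)] by (simp add: Hdiv_ip_def)
    show ?thesis
      using L2_ip_self_eq_0_imp_AE[OF d(1) u0] L2_ip_self_eq_0_imp_AE[OF d2(1) v0] L2_ip_self_eq_0_imp_AE[OF d2(3) \<alpha>0]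
      by eventually_elim simp
  qed
  ultimately show ?thesis by blast
qed

end

end

theorem corollary10:
  fixes \<Omega> \<Gamma>\<^sub>0 \<Gamma>\<^sub>2 \<Gamma>\<^sub>3 :: "(real^'n) set"
    and c\<^sub>0 c\<^sub>1 :: real
    and f F :: "(real^'n \<Rightarrow> real) \<Rightarrow> real"
  assumes "CARD('n) \<in> {2, 3}"
    and "lipschitz_polytope_domain \<Omega>"
    and "boundary_segment \<Omega> \<Gamma>\<^sub>0" "boundary_segment \<Omega> \<Gamma>\<^sub>2" "boundary_segment \<Omega> \<Gamma>\<^sub>3"
    and "nonoverlapping \<Omega> \<Gamma>\<^sub>0 \<Gamma>\<^sub>2" "nonoverlapping \<Omega> \<Gamma>\<^sub>0 \<Gamma>\<^sub>3" "nonoverlapping \<Omega> \<Gamma>\<^sub>2 \<Gamma>\<^sub>3"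
    and "frontier \<Omega> = \<Gamma>\<^sub>0 \<union> \<Gamma>\<^sub>2 \<union> \<Gamma>\<^sub>3"
    and "f \<in> V_dual \<Omega>" "load_functional \<Omega> f F"
    and "c\<^sub>0 > 0" "c\<^sub>1 > 0"
  shows "\<exists>u v \<alpha>. saddle_point_solution c\<^sub>0 c\<^sub>1 \<Omega> \<Gamma>\<^sub>2 \<Gamma>\<^sub>3 F u v \<alpha> \<and>
           (\<forall>u' v' \<alpha>'. saddle_point_solution c\<^sub>0 c\<^sub>1 \<Omega> \<Gamma>\<^sub>2 \<Gamma>\<^sub>3 F u' v' \<alpha>' \<longrightarrow>
              (AE x in lebesgue_on \<Omega>. u' x = u x \<and> v' x = v x \<and> \<alpha>' x = \<alpha> x))"
proof -
  interpret bounded_open_set \<Omega>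
    using assms(2) by unfold_locales (auto simp: lipschitz_polytope_domain_def)
  show ?thesis
    using assms by (intro saddle_point_well_posed) (simp_all add: load_functional_def)
qed

end
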